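(* Let $\lambda>0$, let $\mu,\nu\in P_2(\mathbb{R}^d)$ be absolutely continuous with respect to Lebesgue measure with non-negative densities $f$ and $g$, and let $\varphi:\mathbb{R}^d\to\mathbb{R}$ be such that $(\mu,\nu,\varphi)$ is $\lambda$-regular; let $T=\nabla\varphi$ be the optimal transport map from $\mu$ to $\nu$. Let $Y=\{y\in\mathbb{R}^d:g(y)>0\}$, and assume that $Y$ is a bounded convex set and that $g(y)\in[c_1,c_2]$ for all $y\in Y$, for some $c_2\ge c_1>0$. Let $\mu_h=\sum_{i=1}^Nf_i\delta_{x_i}$ be a probability measure with distinct nodes $x_1,\dots,x_N\in\mathbb{R}^d$ and $f_i>0$ for all $i$. Let $\varphi_h=(\varphi_h(x_i))_{i=1}^N\in\mathbb{R}^N$ be a nodal function solving $$\nu(F_i)=f_i,\qquad F_i:=\partial\varphi_h(x_i)\cap Y,\qquad i=1,\dots,N,$$ and let $$m_i:=\frac1{f_i}\int_{F_i}y\,g(y)\,dy$$ be the barycenter of $F_i$ with respect to $\nu$. Then there exists a constant $C>0$ depending only on $d,c_1,c_2$ such that $$\sum_{i=1}^Nf_i\Big(|T(x_i)-m_i|^2+C\,\mathrm{diam}(F_i)^2\Big)\le E_h^2,$$ where $$E_h:=2\lambda^{1/2}\,W_2(\mu,\mu_h)^{1/2}\big(W_2(\mu,\nu)+W_2(\mu,\mu_h)\big)^{1/2}+\lambda W_2(\mu,\mu_h).$$ Moreover, there exists a constant $C$ depending only on $(d,\mu,\nu,c_1,c_2)$ such that, whenever $0<h\le\lambda^{-1}$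 and $\mu_h$ satisfies $W_2(\mu,\mu_h)\le h$, $$\sum_{i=1}^Nf_i\,|T(x_i)-m_i|^2\le C\lambda h,\qquad \sum_{i=1}^Nf_i\,\mathrm{diam}(F_i)^2\le C\lambda h.$$
   Context: $P_2(\mathbb{R}^d)$ is the set of Borel probability measures on $\mathbb{R}^d$ with finite second moment. $W_2(\mu,\nu)=\big(\min_{\gamma}\int|x-y|^2\,d\gamma(x,y)\big)^{1/2}$, the minimum being over all couplings (transport plans) $\gamma$ of $\mu$ and $\nu$, is the quadratic Wasserstein distance. A map $T$ is an optimal transport map from $\mu$ to $\nu$ if $T_\#\mu=\nu$ and $T$ minimizes $\int|x-S(x)|^2\,d\mu(x)$ among all measurable maps $S$ with $S_\#\mu=\nu$. $\lambda$-regularity: $(\mu,\nu,\varphi)$ is $\lambda$-regular ($\lambda>0$) if $\varphi:\mathbb{R}^d\to\mathbb{R}$ is convex, $\nabla\varphi$ is the optimal transport map from $\mu$ to $\nu$ (for the quadratic cost), and $\varphi$ is $\lambda$-smooth, meaning $$\varphi((1-t)x_0+tx_1)+\frac{t(1-t)\lambda}{2}|x_0-x_1|^2\ge(1-t)\varphi(x_0)+t\varphi(x_1)$$ for all $x_0,x_1\in\mathbb{R}^d$, $t\in[0,1]$; equivalently, $\frac{\lambda}{2}|x|^2-\varphi(x)$ is convex. (Such a $\varphi$ is differentiable everywhere, so $T=\nabla\varphi$ is defined on all of $\mathbb{R}^d$.) Discrete subdifferential: for a nodal function $\varphi_h:\{x_1,\dots,x_N\}\to\mathbb{R}$, $$\partial\varphi_h(x_i):=\{y\in\mathbb{R}^d:\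 \varphi_h(x_i)+(x_j-x_i)\cdot y\le\varphi_h(x_j)\ \ \forall j=1,\dots,N\}.$$ The sets $F_i=\partial\varphi_h(x_i)\cap Y$ are called Laguerre cells. *)

theory Defs
  imports "HOL-Probability.Probability"
begin

definition P2 :: "'a::euclidean_space measure set" where
  "P2 = {\<mu>. prob_space \<mu> \<and> sets \<mu> = sets borel \<and> integrable \<mu> (\<lambda>x. (norm x)\<^sup>2)}"

definition couplings :: "'a::euclidean_space measure \<Rightarrow> 'a measure \<Rightarrow> ('a \<times> 'a) measure set" where
  "couplings \<mu> \<nu> =
     {\<gamma>. sets \<gamma> = sets borel \<and> distr \<gamma> borel fst = \<mu> \<and> distr \<gamma> borel snd = \<nu>}"

text \<open>
  On \<^const>\<open>P2\<close> the infimum is finite and attained, so it is the usual minimum over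
  transport plans.
\<close>
definition W2 :: "'a::euclidean_space measure \<Rightarrow> 'a measure \<Rightarrow> real" where
  "W2 \<mu> \<nu> =
     sqrt (enn2real (INF \<gamma>\<in>couplings \<mu> \<nu>. \<integral>\<^sup>+p. ennreal ((norm (fst p - snd p))\<^sup>2) \<partial>\<gamma>))"

definition optimal_transport_map ::
  "'a::euclidean_space measure \<Rightarrow> 'a measure \<Rightarrow> ('a \<Rightarrow> 'a) \<Rightarrow> bool" where
  "optimal_transport_map \<mu> \<nu> T \<longleftrightarrow>
     T \<in> borel_measurable borel \<and> distr \<mu> borel T = \<nu> \<and>
     (\<forall>S. S \<in> borel_measurable borel \<longrightarrow> distr \<mu> borel S = \<nu> \<longrightarrow>
        (\<integral>\<^sup>+x. ennreal ((norm (x - T x))\<^sup>2) \<partial>\<mu>) \<le> (\<integral>\<^sup>+x. ennreal ((norm (x - S x))\<^sup>2) \<partial>\<mu>))"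

text \<open>
  The value is unspecified where the function is not differentiable; a function as in
  \<open>lambda_regular\<close> below is differentiable everywhere.
\<close>
definition gradient :: "('a::euclidean_space \<Rightarrow> real) \<Rightarrow> 'a \<Rightarrow> 'a" where
  "gradient \<phi> x = (THE D. GDERIV \<phi> x :> D)"

lemma gradient_eqI:
  assumes "GDERIV \<phi> x :> D"
  shows "gradient \<phi> x = D"
  unfolding gradient_def
proof (rule the_equality)
  fix E assume "GDERIV \<phi> x :> E"
  with assms have "(\<lambda>h. h \<bullet> E) = (\<lambda>h. h \<bullet> D)"
    unfolding gderiv_def by (rule has_derivative_unique[rotated])
  then show "E = D"
    by (metis vector_eq_ldot)
qed (fact assms)

definition lambda_smooth :: "real \<Rightarrow> ('a::euclidean_space \<Rightarrow> real) \<Rightarrow> bool" where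
  "lambda_smooth lam \<phi> \<longleftrightarrow>
     (\<forall>x0 x1. \<forall>t\<in>{0..1}.
        \<phi> ((1 - t) *\<^sub>R x0 + t *\<^sub>R x1) + t * (1 - t) * lam / 2 * (norm (x0 - x1))\<^sup>2
          \<ge> (1 - t) * \<phi> x0 + t * \<phi> x1)"

definition lambda_regular ::
  "real \<Rightarrow> 'a::euclidean_space measure \<Rightarrow> 'a measure \<Rightarrow> ('a \<Rightarrow> real) \<Rightarrow> bool" where
  "lambda_regular lam \<mu> \<nu> \<phi> \<longleftrightarrow>
     0 < lam \<and> convex_on UNIV \<phi> \<and> optimal_transport_map \<mu> \<nu> (gradient \<phi>) \<and>
     lambda_smooth lam \<phi>"

definition is_density :: "'a::euclidean_space measure \<Rightarrow> ('a \<Rightarrow> real) \<Rightarrow> bool" where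
  "is_density \<mu> f \<longleftrightarrow>
     f \<in> borel_measurable borel \<and> (\<forall>x. 0 \<le> f x) \<and> \<mu> = density lborel (\<lambda>x. ennreal (f x))"

definition transport_setting ::
  "real \<Rightarrow> real \<Rightarrow> real \<Rightarrow> 'a::euclidean_space measure \<Rightarrow> 'a measure \<Rightarrow>
   ('a \<Rightarrow> real) \<Rightarrow> ('a \<Rightarrow> real) \<Rightarrow> ('a \<Rightarrow> real) \<Rightarrow> bool" where
  "transport_setting c1 c2 lam \<mu> \<nu> f g \<phi> \<longleftrightarrow>
     \<mu> \<in> P2 \<and> \<nu> \<in> P2 \<and> is_density \<mu> f \<and> is_density \<nu> g \<and> lambda_regular lam \<mu> \<nu> \<phi> \<and>
     bounded {y. 0 < g y} \<and> convex {y. 0 < g y} \<and> (\<forall>y\<in>{y. 0 < g y}. g y \<in> {c1..c2})"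

text \<open>The measure \<open>\<Sum>i=1..N. w i \<cdot> \<delta>(x i)\<close>, see \<open>emeasure_discrete_measure\<close>.\<close>
definition discrete_measure ::
  "nat \<Rightarrow> (nat \<Rightarrow> 'a::euclidean_space) \<Rightarrow> (nat \<Rightarrow> real) \<Rightarrow> 'a measure" where
  "discrete_measure N x w = distr (point_measure {1..N} (\<lambda>i. ennreal (w i))) borel x"

lemma emeasure_discrete_measure:
  assumes "A \<in> sets borel"
  shows "emeasure (discrete_measure N x w) A = (\<Sum>i=1..N. ennreal (w i) * indicator A (x i))"
proof -
  have "emeasure (discrete_measure N x w) A =
          emeasure (point_measure {1..N} (\<lambda>i. ennreal (w i))) {i\<in>{1..N}. x i \<in> A}"
    unfolding discrete_measure_def using assms
    by (subst emeasure_distr)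
       (auto simp: space_point_measure measurable_point_measure_eq1 intro!: arg_cong2[of _ _ _ _ emeasure])
  also have "\<dots> = (\<Sum>i\<in>{i\<in>{1..N}. x i \<in> A}. ennreal (w i))"
    by (rule emeasure_point_measure_finite) auto
  also have "\<dots> = (\<Sum>i=1..N. ennreal (w i) * indicator A (x i))"
    by (rule sum.mono_neutral_cong_left) auto
  finally show ?thesis .
qed

text \<open>
  A nodal function is represented by a function on the whole space, of which only the values on
  the set \<open>X\<close> of nodes are used.
\<close>
definition discrete_subdifferential ::
  "'a::euclidean_space set \<Rightarrow> ('a \<Rightarrow> real) \<Rightarrow> 'a \<Rightarrow> 'a set" where
  "discrete_subdifferential X \<phi>h p = {y. \<forall>q\<in>X. \<phi>h p + (q - p) \<bullet> y \<le> \<phi>h q}"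

definition laguerre_cell ::
  "('a::euclidean_space \<Rightarrow> real) \<Rightarrow> nat \<Rightarrow> (nat \<Rightarrow> 'a) \<Rightarrow> ('a \<Rightarrow> real) \<Rightarrow> nat \<Rightarrow> 'a set" where
  "laguerre_cell g N x \<phi>h i = discrete_subdifferential (x ` {1..N}) \<phi>h (x i) \<inter> {y. 0 < g y}"

definition semidiscrete_solution ::
  "'a::euclidean_space measure \<Rightarrow> ('a \<Rightarrow> real) \<Rightarrow> nat \<Rightarrow> (nat \<Rightarrow> 'a) \<Rightarrow> (nat \<Rightarrow> real) \<Rightarrow>
   ('a \<Rightarrow> real) \<Rightarrow> bool" where
  "semidiscrete_solution \<nu> g N x w \<phi>h \<longleftrightarrow>
     prob_space (discrete_measure N x w) \<and> inj_on x {1..N} \<and>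
     (\<forall>i\<in>{1..N}. 0 < w i) \<and>
     (\<forall>i\<in>{1..N}. measure \<nu> (laguerre_cell g N x \<phi>h i) = w i)"

definition cell_barycenter ::
  "('a::euclidean_space \<Rightarrow> real) \<Rightarrow> nat \<Rightarrow> (nat \<Rightarrow> 'a) \<Rightarrow> (nat \<Rightarrow> real) \<Rightarrow> ('a \<Rightarrow> real) \<Rightarrow> nat \<Rightarrow> 'a" where
  "cell_barycenter g N x w \<phi>h i =
     (1 / w i) *\<^sub>R (LINT y:laguerre_cell g N x \<phi>h i|lborel. g y *\<^sub>R y)"

definition error_bound ::
  "real \<Rightarrow> 'a::euclidean_space measure \<Rightarrow> 'a measure \<Rightarrow> 'a measure \<Rightarrow> real" where
  "error_bound lam \<mu> \<nu> \<mu>h =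
     2 * sqrt lam * sqrt (W2 \<mu> \<mu>h) * sqrt (W2 \<mu> \<nu> + W2 \<mu> \<mu>h) + lam * W2 \<mu> \<mu>h"

end

theory Submission
  imports Defs
begin

text \<open>
  Let \<open>X\<close>, \<open>Z\<close>, \<open>Y\<close> be random points with laws \<open>\<mu>\<close>, \<open>\<mu>\<^sub>h\<close>, \<open>\<nu>\<close>, where \<open>(X, Z)\<close> is an optimal
  plan and \<open>Y\<close> lies in the Laguerre cell of the node \<open>Z\<close>; write \<open>a\<close> for the distance of \<open>\<mu>\<close> and
  \<open>\<mu>\<^sub>h\<close> and \<open>b\<close> for that of \<open>\<mu>\<close> and \<open>\<nu>\<close>. Smoothness of \<open>\<phi>\<close> makes its conjugate strongly convex,
  so the Fenchel gap dominates \<open>|T X - Y|\<^sup>2 / (2 \<lambda>)\<close>. As \<open>T X\<close> and \<open>Y\<close> have the same law, integration gives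
  \<open>\<parallel>T X - Y\<parallel>\<^sup>2 \<le> \<lambda> (\<parallel>X - Y\<parallel>\<^sup>2 - \<parallel>X - T X\<parallel>\<^sup>2)\<close>. The nodal function is a dual certificate for the
  optimality of \<open>(Z, Y)\<close>, hence \<open>\<parallel>Z - Y\<parallel> \<le> \<parallel>Z - T X\<parallel> \<le> a + b\<close> and
  \<open>\<parallel>T X - Y\<parallel>\<^sup>2 \<le> \<lambda> ((2 a + b)\<^sup>2 - b\<^sup>2)\<close>. Since \<open>T\<close> is \<open>\<lambda>\<close>-Lipschitz, \<open>\<parallel>T Z - Y\<parallel>\<close> is at most the error
  bound. On each cell, \<open>|T x\<^sub>i - y|\<^sup>2\<close> splits into the squared distance to the barycenter and the
  variance of the cell, which for a convex cell is at least a multiple of the squared diameter.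
  For the second part, \<open>1 / \<lambda>\<close>, and with it \<open>h\<close>, is bounded in terms of \<open>\<mu>\<close> and \<open>\<nu>\<close>, because
  the variance of \<open>\<nu>\<close> is positive and at most \<open>\<lambda>\<^sup>2\<close> times the second moment of \<open>\<mu>\<close>.
\<close>

section \<open>Convex functions with a quadratic upper bound\<close>

text \<open>The strict epigraph, translated so that \<open>(x, \<phi> x)\<close> becomes the origin,
  is convex and misses the origin, so a hyperplane separates the two. Since \<phi> is finite
  everywhere the hyperplane is not vertical, and its slope is a subgradient.\<close>

lemma convex_on_UNIV_subgradient:
  fixes \<phi> :: "'a::euclidean_space \<Rightarrow> real"
  assumes "convex_on UNIV \<phi>"
  obtains p where "\<And>v. \<phi> x + v \<bullet> p \<le> \<phi> (x + v)"
proof -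
  define S where "S = {(v, t). \<phi> (x + v) - \<phi> x < t}"
  have "convex S"
    unfolding convex_alt
  proof (intro ballI allI impI)
    fix P Q u assume "P \<in> S" "Q \<in> S" and u: "0 \<le> u \<and> u \<le> (1::real)"
    then obtain v s w t where PQ: "P = (v, s)" "Q = (w, t)"
      and st: "\<phi> (x + v) - \<phi> x < s" "\<phi> (x + w) - \<phi> x < t"
      by (auto simp: S_def)
    have "\<phi> (x + ((1 - u) *\<^sub>R v + u *\<^sub>R w)) = \<phi> ((1 - u) *\<^sub>R (x + v) + u *\<^sub>R (x + w))"
      by (rule arg_cong[of _ _ \<phi>]) (simp add: algebra_simps)
    also have "\<dots> \<le> (1 - u) * \<phi> (x + v) + u * \<phi> (x + w)"
      using convex_onD[OF assms] u by simp
    finally have 1: "\<phi> (x + ((1 - u) *\<^sub>R v + u *\<^sub>R w)) - \<phi> x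
        \<le> (1 - u) * (\<phi> (x + v) - \<phi> x) + u * (\<phi> (x + w) - \<phi> x)"
      by (simp add: algebra_simps)
    have 2: "(1 - u) * (\<phi> (x + v) - \<phi> x) + u * (\<phi> (x + w) - \<phi> x) < (1 - u) * s + u * t"
    proof (cases "u = 1")
      case False
      then show ?thesis
        using u st by (intro add_less_le_mono mult_strict_left_mono mult_left_mono) auto
    qed (use st in simp)
    show "(1 - u) *\<^sub>R P + u *\<^sub>R Q \<in> S"
      using order_le_less_trans[OF 1 2] by (simp add: PQ S_def)
  qed
  moreover have "0 \<notin> S"
    by (simp add: S_def zero_prod_def)
  ultimately obtain a where "a \<noteq> 0" and a: "\<forall>z\<in>S. 0 \<le> inner a z"
    using separating_hyperplane_set_0 by blast
  obtain q s where qs: "a = (q, s)"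
    by (cases a)
  have sep: "0 \<le> q \<bullet> v + s * t" if "\<phi> (x + v) - \<phi> x < t" for v t
    using a that by (force simp: S_def qs)
  have "0 \<le> s"
    using sep[of 0 1] by simp
  moreover have "s \<noteq> 0"
  proof
    assume "s = 0"
    \<comment> \<open>A vertical hyperplane would have to bound every direction; the direction
      \<open>- q\<close> refutes this unless \<open>q = 0\<close>.\<close>
    then have "0 \<le> q \<bullet> (- q)"
      using sep[of "- q" "\<phi> (x - q) - \<phi> x + 1"] by simp
    then have "q = 0"
      using inner_ge_zero[of q] inner_eq_zero_iff[of q] by simp
    then show False
      using \<open>a \<noteq> 0\<close> qs \<open>s = 0\<close> by (simp add: zero_prod_def)
  qed
  ultimately have s: "0 < s"
    by simp
  have "\<phi> x + v \<bullet> (- (q /\<^sub>R s)) \<le> \<phi> (x + v)" for v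
  proof -
    have "- (q \<bullet> v) / s \<le> \<phi> (x + v) - \<phi> x"
    \<comment> \<open>The epigraph is strict, so the bound is available only for \<open>t\<close>
      above the increment of \<phi> and reaches the increment itself by density.\<close>
    proof (rule dense_ge)
      fix t assume "\<phi> (x + v) - \<phi> x < t"
      with sep[of v t] s show "- (q \<bullet> v) / s \<le> t"
        by (simp add: field_simps)
    qed
    then show ?thesis
      by (simp add: inner_commute divide_inverse_commute)
  qed
  then show thesis
    by (rule that)
qed

text \<open>Smoothness is applied on the segment from \<open>x + v\<close> to
  \<open>x - t v\<close>, which contains \<open>x\<close>, and the value at \<open>x - t v\<close>
  is bounded below by the subgradient. The resulting constant \<open>(1 + t) * lam / 2\<close>
  becomes sharp as \<open>t\<close> tends to zero.\<close>

lemma lambda_smooth_subgradient_upper: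
  fixes \<phi> :: "'a::euclidean_space \<Rightarrow> real"
  assumes smooth: "lambda_smooth lam \<phi>" and p: "\<And>v. \<phi> x + v \<bullet> p \<le> \<phi> (x + v)"
  shows "\<phi> (x + v) \<le> \<phi> x + v \<bullet> p + lam / 2 * (norm v)\<^sup>2"
proof -
  have upper: "\<phi> (x + v) \<le> \<phi> x + v \<bullet> p + (1 + t) * (lam / 2 * (norm v)\<^sup>2)" if t: "0 < t" for t
  proof -
    \<comment> \<open>This is the weight of \<open>x - t v\<close> in the convex combination equal
      to \<open>x\<close>; the weight of \<open>x + v\<close> is then
      \<open>1 - s = t * s\<close>.\<close>
    define s where "s = 1 / (1 + t)"
    have s: "0 < s" "s < 1" "(1 + t) * s = 1"
      using t by (auto simp: s_def)
    have ts: "t * s = 1 - s"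
      using s(3) by (simp add: algebra_simps)
    have pt: "(1 - s) *\<^sub>R (x + v) + s *\<^sub>R (x + (- t) *\<^sub>R v) = x"
    proof -
      have "(1 - s) *\<^sub>R (x + v) + s *\<^sub>R (x + (- t) *\<^sub>R v) = x + (1 - s - t * s) *\<^sub>R v"
        by (simp add: algebra_simps)
      then show ?thesis by (simp add: ts)
    qed
    have df: "x + v - (x + (- t) *\<^sub>R v) = (1 + t) *\<^sub>R v"
      by (simp add: algebra_simps)
    have "(1 - s) * \<phi> (x + v) + s * \<phi> (x + (- t) *\<^sub>R v)
        \<le> \<phi> x + s * (1 - s) * lam / 2 * (norm ((1 + t) *\<^sub>R v))\<^sup>2"
      using smooth s unfolding lambda_smooth_def
      by (metis pt df atLeastAtMost_iff less_eq_real_def)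
    moreover have "s * (1 - s) * lam / 2 * (norm ((1 + t) *\<^sub>R v))\<^sup>2
        = t * ((1 + t) * s)\<^sup>2 * (lam / 2 * (norm v)\<^sup>2)"
      by (simp add: power_mult_distrib ts[symmetric] power2_eq_square)
    moreover have "s * (\<phi> x - t * (v \<bullet> p)) \<le> s * \<phi> (x + (- t) *\<^sub>R v)"
      using p[of "(- t) *\<^sub>R v"] s by (intro mult_left_mono) auto
    ultimately have "(t * s) * \<phi> (x + v) \<le> \<phi> x + t * (lam / 2 * (norm v)\<^sup>2) - s * (\<phi> x - t * (v \<bullet> p))"
      unfolding s(3) ts power_one mult_1_right by linarith
    then have "(1 + t) * ((t * s) * \<phi> (x + v))
        \<le> (1 + t) * (\<phi> x + t * (lam / 2 * (norm v)\<^sup>2) - s * (\<phi> x - t * (v \<bullet> p)))"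
      using t by (intro mult_left_mono) auto
    also have "(1 + t) * ((t * s) * \<phi> (x + v)) = ((1 + t) * s) * (t * \<phi> (x + v))"
      by simp
    also have "(1 + t) * (\<phi> x + t * (lam / 2 * (norm v)\<^sup>2) - s * (\<phi> x - t * (v \<bullet> p)))
       = (1 + t) * (\<phi> x + t * (lam / 2 * (norm v)\<^sup>2)) - ((1 + t) * s) * (\<phi> x - t * (v \<bullet> p))"
      by (simp add: algebra_simps)
    finally have "t * \<phi> (x + v) \<le> t * (\<phi> x + v \<bullet> p + (1 + t) * (lam / 2 * (norm v)\<^sup>2))"
      unfolding s(3) by (simp add: algebra_simps)
    then show ?thesis
      using t by simp
  qed
  have "((\<lambda>t. \<phi> x + v \<bullet> p + (1 + t) * (lam / 2 * (norm v)\<^sup>2)) \<longlongrightarrow>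
      \<phi> x + v \<bullet> p + (1 + 0) * (lam / 2 * (norm v)\<^sup>2)) (at_right 0)"
    by (intro tendsto_intros)
  moreover have "\<forall>\<^sub>F t in at_right 0. \<phi> (x + v) \<le> \<phi> x + v \<bullet> p + (1 + t) * (lam / 2 * (norm v)\<^sup>2)"
    using eventually_at_right_less[of "0::real"] by eventually_elim (rule upper)
  ultimately show ?thesis
    using tendsto_lowerbound[of _ _ "at_right (0::real)"] by fastforce
qed

text \<open>The first-order remainder lies between zero and a multiple of the squared increment, so
  it vanishes after division by the length of the increment.\<close>

lemma GDERIV_from_quadratic_bounds:
  fixes \<phi> :: "'a::euclidean_space \<Rightarrow> real"
  assumes "\<And>v. \<phi> x + v \<bullet> p \<le> \<phi> (x + v)" "\<And>v. \<phi> (x + v) \<le> \<phi> x + v \<bullet> p + K * (norm v)\<^sup>2"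
  shows "GDERIV \<phi> x :> p"
  unfolding gderiv_def has_derivative_at
proof (intro conjI)
  show "bounded_linear (\<lambda>h. h \<bullet> p)"
    by (rule bounded_linear_inner_left)
  show "(\<lambda>h. norm (\<phi> (x + h) - \<phi> x - h \<bullet> p) / norm h) \<midarrow>0\<rightarrow> 0"
  proof (rule Lim_null_comparison)
    show "\<forall>\<^sub>F h in at 0. norm (norm (\<phi> (x + h) - \<phi> x - h \<bullet> p) / norm h) \<le> K * norm h"
      unfolding eventually_at_filter
    proof (intro always_eventually allI impI)
      fix h :: 'a assume "h \<noteq> 0"
      then show "norm (norm (\<phi> (x + h) - \<phi> x - h \<bullet> p) / norm h) \<le> K * norm h"
        using assms[of h] by (simp add: divide_le_eq power2_eq_square)
    qed
    show "(\<lambda>h. K * norm h) \<midarrow>0\<rightarrow> 0"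
      by (intro tendsto_eq_intros) auto
  qed
qed

section \<open>The shifted convex conjugate and the Lipschitz bound for the gradient\<close>

locale smooth_convex =
  fixes \<phi> :: "'a::euclidean_space \<Rightarrow> real" and T :: "'a \<Rightarrow> 'a" and lam :: real
  assumes lam_pos: "0 < lam"
    and lower: "\<phi> x + v \<bullet> T x \<le> \<phi> (x + v)"
    and upper: "\<phi> (x + v) \<le> \<phi> x + v \<bullet> T x + lam / 2 * (norm v)\<^sup>2"
begin

text \<open>This is the Legendre conjugate of \<phi> plus \<open>\<phi> 0\<close>. The shift makes
  the term for \<open>x = 0\<close> vanish, so the supremum is nonnegative and truncation by
  \<open>ennreal\<close> does not change it; the value \<open>\<top>\<close> stands for an infinite
  conjugate.\<close>

definition conjugate :: "'a \<Rightarrow> ennreal"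
  where "conjugate y = (SUP x. ennreal (x \<bullet> y - \<phi> x + \<phi> 0))"

text \<open>Although the supremum is uncountable, it is lower semicontinuous: its strict superlevel
  sets are unions of open sets.\<close>

lemma borel_measurable_conjugate [measurable]: "conjugate \<in> borel_measurable borel"
proof (rule borel_measurableI_greater)
  fix c
  have "{y \<in> space borel. c < conjugate y} = (\<Union>x. (\<lambda>y. ennreal (x \<bullet> y - \<phi> x + \<phi> 0)) -` {c<..})"
    by (auto simp: conjugate_def less_SUP_iff)
  moreover have "open ((\<lambda>y. ennreal (x \<bullet> y - \<phi> x + \<phi> 0)) -` {c<..})" for x
    by (intro open_vimage open_greaterThan continuous_on_ennreal continuous_intros)
  ultimately show "{y \<in> space borel. c < conjugate y} \<in> sets borel"
    by (metis (no_types, lifting) borel_open open_UN)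
qed

text \<open>Equality case of the Fenchel-Young inequality: the lower bound at \<open>x\<close> says
  that the supremum for the slope \<open>T x\<close> is attained at \<open>x\<close>.\<close>

lemma conjugate_gradient: "conjugate (T x) = ennreal (x \<bullet> T x - \<phi> x + \<phi> 0)"
  unfolding conjugate_def
proof (rule antisym)
  show "(SUP z. ennreal (z \<bullet> T x - \<phi> z + \<phi> 0)) \<le> ennreal (x \<bullet> T x - \<phi> x + \<phi> 0)"
  proof (intro SUP_least ennreal_leI)
    fix z
    show "z \<bullet> T x - \<phi> z + \<phi> 0 \<le> x \<bullet> T x - \<phi> x + \<phi> 0"
      using lower[of x "z - x"] by (simp add: inner_diff_left)
  qed
qed (rule SUP_upper, simp)

lemma conjugate_gradient_nonneg: "0 \<le> x \<bullet> T x - \<phi> x + \<phi> 0"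
  using lower[of x "- x"] by simp

text \<open>With \<open>conjugate_gradient_nonneg\<close>, this dominates the conjugate along
  \<open>T\<close> by inner products of square-integrable fields, which gives its
  integrability.\<close>

lemma conjugate_gradient_le: "x \<bullet> T x - \<phi> x + \<phi> 0 \<le> x \<bullet> T x - x \<bullet> T 0"
  using lower[of 0 x] by simp

lemma conjugate_real_gradient: "enn2real (conjugate (T x)) = x \<bullet> T x - \<phi> x + \<phi> 0"
  using conjugate_gradient_nonneg by (simp add: conjugate_gradient)

text \<open>The supremum defining the conjugate at \<open>y\<close> is tested at the point
  \<open>x + (y - T x) / lam\<close>, where the quadratic upper bound is optimal.\<close>

lemma conjugate_gap:
  assumes "conjugate y < \<top>"
  shows "(norm (T x - y))\<^sup>2 / (2 * lam) \<le> \<phi> x - \<phi> 0 + enn2real (conjugate y) - x \<bullet> y"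
proof -
  have ge: "z \<bullet> y - \<phi> z + \<phi> 0 \<le> enn2real (conjugate y)" for z
  proof -
    have "ennreal (z \<bullet> y - \<phi> z + \<phi> 0) \<le> conjugate y"
      unfolding conjugate_def by (rule SUP_upper) simp
    also have "conjugate y = ennreal (enn2real (conjugate y))"
      using assms by simp
    finally show ?thesis
      using enn2real_nonneg[of "conjugate y"] unfolding ennreal_le_iff2 by linarith
  qed
  define v where "v = (y - T x) /\<^sub>R lam"
  have "norm v = norm (T x - y) / lam"
    using lam_pos by (simp add: v_def norm_minus_commute divide_inverse_commute)
  then have vv: "lam / 2 * (norm v)\<^sup>2 = (norm (T x - y))\<^sup>2 / (2 * lam)"
    using lam_pos by (simp add: power_divide power2_eq_square[of lam])
  have "v \<bullet> y - v \<bullet> T x = (norm (T x - y))\<^sup>2 / lam"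
    by (simp add: v_def power2_norm_eq_inner algebra_simps inner_commute divide_inverse)
  then show ?thesis
    using ge[of "x + v"] upper[of x v] vv by (simp add: inner_add_left)
qed

text \<open>Adding the gap inequality for \<open>y = T z\<close> to the one with \<open>x\<close>
  and \<open>z\<close> exchanged gives cocoercivity of \<open>T\<close>; the Cauchy-Schwarz
  inequality then yields the Lipschitz bound.\<close>

lemma gradient_lipschitz: "norm (T x - T z) \<le> lam * norm (x - z)"
proof -
  have gap: "(norm (T x - T z))\<^sup>2 / (2 * lam) \<le> \<phi> x - \<phi> z + z \<bullet> T z - x \<bullet> T z" for x z
    using conjugate_gap[of "T z" x] by (simp add: conjugate_gradient conjugate_gradient_nonneg)
  have "(norm (T x - T z))\<^sup>2 / lam
      = (norm (T x - T z))\<^sup>2 / (2 * lam) + (norm (T z - T x))\<^sup>2 / (2 * lam)"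
    by (simp add: norm_minus_commute)
  also have "\<dots> \<le> (x - z) \<bullet> (T x - T z)"
    using gap[of x z] gap[of z x] by (simp add: inner_diff_left inner_diff_right)
  also have "\<dots> \<le> norm (x - z) * norm (T x - T z)"
    by (rule norm_cauchy_schwarz)
  finally have "norm (T x - T z) * norm (T x - T z) \<le> (lam * norm (x - z)) * norm (T x - T z)"
    using lam_pos by (simp add: field_simps power2_eq_square)
  then show ?thesis
    using lam_pos by (cases "T x = T z") auto
qed

end

text \<open>A subgradient satisfies both quadratic bounds, hence is the derivative and the value
  chosen by \<open>gradient\<close>. From here on \<phi> enters through the two inequalities of the
  locale.\<close>

lemma smooth_convex_gradient:
  assumes "convex_on UNIV \<phi>" "lambda_smooth lam \<phi>" "0 < lam"
  shows "smooth_convex \<phi> (gradient \<phi>) lam"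
proof
  fix x v
  obtain p where p: "\<And>v. \<phi> x + v \<bullet> p \<le> \<phi> (x + v)"
    using convex_on_UNIV_subgradient[OF assms(1)] by blast
  note u = lambda_smooth_subgradient_upper[OF assms(2) p]
  have "gradient \<phi> x = p"
    by (rule gradient_eqI, rule GDERIV_from_quadratic_bounds[OF p u])
  then show "\<phi> x + v \<bullet> gradient \<phi> x \<le> \<phi> (x + v)"
    "\<phi> (x + v) \<le> \<phi> x + v \<bullet> gradient \<phi> x + lam / 2 * (norm v)\<^sup>2"
    using p u by auto
qed fact

section \<open>Square-integrable vector fields\<close>

definition square_integrable :: "'b measure \<Rightarrow> ('b \<Rightarrow> 'a::euclidean_space) \<Rightarrow> bool" where
  "square_integrable M u \<longleftrightarrow> u \<in> borel_measurable M \<and> integrable M (\<lambda>\<omega>. (norm (u \<omega>))\<^sup>2)"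

definition L2_norm :: "'b measure \<Rightarrow> ('b \<Rightarrow> 'a::euclidean_space) \<Rightarrow> real" where
  "L2_norm M u = sqrt (\<integral>\<omega>. (norm (u \<omega>))\<^sup>2 \<partial>M)"

lemma L2_norm_nonneg [simp]: "0 \<le> L2_norm M u"
  by (simp add: L2_norm_def)

lemma L2_norm_power2: "(L2_norm M u)\<^sup>2 = (\<integral>\<omega>. (norm (u \<omega>))\<^sup>2 \<partial>M)"
  by (simp add: L2_norm_def)

lemma L2_norm_minus_commute: "L2_norm M (\<lambda>\<omega>. u \<omega> - v \<omega>) = L2_norm M (\<lambda>\<omega>. v \<omega> - u \<omega>)"
  by (simp add: L2_norm_def norm_minus_commute)

text \<open>Young's inequality, obtained by expanding the square of
  \<open>sqrt t *\<^sub>R u - (1 / sqrt t) *\<^sub>R v\<close>. The free weight \<open>t\<close> is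
  tuned in \<open>L2_norm_triangle\<close>.\<close>

lemma norm_add_power2_le:
  fixes u v :: "'a::real_inner"
  assumes "0 < t"
  shows "(norm (u + v))\<^sup>2 \<le> (1 + t) * (norm u)\<^sup>2 + (1 + 1 / t) * (norm v)\<^sup>2"
proof -
  have "0 \<le> (norm (sqrt t *\<^sub>R u - (1 / sqrt t) *\<^sub>R v))\<^sup>2"
    by simp
  also have "\<dots> = t * (norm u)\<^sup>2 + (1 / t) * (norm v)\<^sup>2 - 2 * (u \<bullet> v)"
    using assms by (simp add: power2_norm_eq_inner inner_diff_left inner_diff_right inner_commute
        real_sqrt_mult_self field_simps)
  finally show ?thesis
    by (simp add: power2_norm_eq_inner inner_add_left inner_add_right inner_commute algebra_simps)
qed

lemma square_integrable_add:
  assumes "square_integrable M u" "square_integrable M v"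
  shows "square_integrable M (\<lambda>\<omega>. u \<omega> + v \<omega>)"
proof -
  have [measurable]: "u \<in> borel_measurable M" "v \<in> borel_measurable M"
    using assms by (auto simp: square_integrable_def)
  have "integrable M (\<lambda>\<omega>. (norm (u \<omega> + v \<omega>))\<^sup>2)"
  proof (rule Bochner_Integration.integrable_bound)
    show "integrable M (\<lambda>\<omega>. 2 * (norm (u \<omega>))\<^sup>2 + 2 * (norm (v \<omega>))\<^sup>2)"
      using assms by (auto simp: square_integrable_def)
    show "AE \<omega> in M. norm ((norm (u \<omega> + v \<omega>))\<^sup>2) \<le> norm (2 * (norm (u \<omega>))\<^sup>2 + 2 * (norm (v \<omega>))\<^sup>2)"
      using norm_add_power2_le[of 1 "u \<omega>" "v \<omega>" for \<omega>] by auto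
  qed simp
  then show ?thesis
    by (simp add: square_integrable_def)
qed

lemma square_integrable_minus: "square_integrable M u \<Longrightarrow> square_integrable M (\<lambda>\<omega>. - u \<omega>)"
  by (simp add: square_integrable_def)

lemma square_integrable_diff:
  "square_integrable M u \<Longrightarrow> square_integrable M v \<Longrightarrow> square_integrable M (\<lambda>\<omega>. u \<omega> - v \<omega>)"
  using square_integrable_add[of M u "\<lambda>\<omega>. - v \<omega>"] square_integrable_minus[of M v] by simp

lemma square_integrable_bound:
  assumes "square_integrable M u" "v \<in> borel_measurable M" "\<And>\<omega>. norm (v \<omega>) \<le> norm (u \<omega>)"
  shows "square_integrable M v"
  using assms unfolding square_integrable_def
  by (auto intro!: Bochner_Integration.integrable_bound[where g = "\<lambda>\<omega>. (norm (v \<omega>))\<^sup>2"] power_mono)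

lemma (in finite_measure) square_integrable_const: "square_integrable M (\<lambda>_. c)"
  by (simp add: square_integrable_def)

lemma (in finite_measure) square_integrable_affine_bound:
  fixes u :: "'a \<Rightarrow> 'b::euclidean_space" and v :: "'a \<Rightarrow> 'c::euclidean_space"
  assumes "square_integrable M u" "v \<in> borel_measurable M" "\<And>\<omega>. norm (v \<omega>) \<le> A + B * norm (u \<omega>)"
  shows "square_integrable M v"
proof -
  have [measurable]: "u \<in> borel_measurable M"
    using assms(1) by (simp add: square_integrable_def)
  have "square_integrable M (\<lambda>\<omega>. A + B * norm (u \<omega>))"
    using assms(1)
    by (intro square_integrable_add square_integrable_const)
       (simp add: square_integrable_def power_mult_distrib)
  moreover have "norm (v \<omega>) \<le> norm (A + B * norm (u \<omega>))" for \<omega>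
    using assms(3)[of \<omega>] by simp
  ultimately show ?thesis
    using assms(2) by (blast intro: square_integrable_bound)
qed

lemma integrable_inner:
  assumes "square_integrable M u" "square_integrable M v"
  shows "integrable M (\<lambda>\<omega>. u \<omega> \<bullet> v \<omega>)"
proof -
  have [measurable]: "u \<in> borel_measurable M" "v \<in> borel_measurable M"
    using assms by (auto simp: square_integrable_def)
  have eq: "u \<omega> \<bullet> v \<omega> = ((norm (u \<omega> + v \<omega>))\<^sup>2 - (norm (u \<omega>))\<^sup>2 - (norm (v \<omega>))\<^sup>2) / 2" for \<omega>
    by (simp add: dot_norm)
  show ?thesis
    unfolding eq using assms square_integrable_add[OF assms] by (auto simp: square_integrable_def)
qed

text \<open>Minkowski's inequality: Young's inequality is integrated with the weight
  \<open>b / a\<close>, for which the right-hand side becomes the square of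
  \<open>a + b\<close>.\<close>

lemma L2_norm_triangle:
  assumes u: "square_integrable M u" and v: "square_integrable M v"
  shows "L2_norm M (\<lambda>\<omega>. u \<omega> + v \<omega>) \<le> L2_norm M u + L2_norm M v"
proof (rule field_le_epsilon)
  fix e :: real assume e: "0 < e"
  \<comment> \<open>The slack keeps \<open>a\<close> and \<open>b\<close> positive even if a norm is
    zero, so that the weight \<open>b / a\<close> makes sense.\<close>
  define a where "a = L2_norm M u + e / 2"
  define b where "b = L2_norm M v + e / 2"
  have ab: "0 < a" "0 < b" "(L2_norm M u)\<^sup>2 \<le> a\<^sup>2" "(L2_norm M v)\<^sup>2 \<le> b\<^sup>2"
    using e by (auto simp: a_def b_def add_nonneg_pos intro!: power_mono)
  have "(L2_norm M (\<lambda>\<omega>. u \<omega> + v \<omega>))\<^sup>2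
      \<le> (\<integral>\<omega>. (1 + b / a) * (norm (u \<omega>))\<^sup>2 + (1 + 1 / (b / a)) * (norm (v \<omega>))\<^sup>2 \<partial>M)"
    unfolding L2_norm_power2 using ab u v square_integrable_add[OF u v]
    by (intro integral_mono norm_add_power2_le) (auto simp: square_integrable_def)
  also have "\<dots> = (1 + b / a) * (L2_norm M u)\<^sup>2 + (1 + a / b) * (L2_norm M v)\<^sup>2"
    using u v by (simp add: L2_norm_power2 square_integrable_def)
  also have "\<dots> \<le> (1 + b / a) * a\<^sup>2 + (1 + a / b) * b\<^sup>2"
    using ab by (intro add_mono mult_left_mono) auto
  also have "\<dots> = (a + b)\<^sup>2"
    using ab by (simp add: power2_eq_square field_simps)
  finally have "L2_norm M (\<lambda>\<omega>. u \<omega> + v \<omega>) \<le> a + b"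
    using ab by (rule_tac power2_le_imp_le) auto
  then show "L2_norm M (\<lambda>\<omega>. u \<omega> + v \<omega>) \<le> L2_norm M u + L2_norm M v + e"
    by (simp add: a_def b_def)
qed

lemma L2_norm_mono:
  assumes "square_integrable M u" "square_integrable M v" "\<And>\<omega>. norm (u \<omega>) \<le> norm (v \<omega>)"
  shows "L2_norm M u \<le> L2_norm M v"
  unfolding L2_norm_def using assms
  by (auto simp: square_integrable_def intro!: integral_mono power_mono)

text \<open>This is how a dual potential cancels: its integral depends only on the law of the point
  at which it is evaluated.\<close>

lemma integral_cong_distr:
  fixes \<beta> :: "'a::euclidean_space \<Rightarrow> real"
  assumes eq: "distr M borel U = distr M borel V"
    and [measurable]: "U \<in> borel_measurable M" "V \<in> borel_measurable M" "\<beta> \<in> borel_measurable borel"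
    and int: "integrable M (\<lambda>\<omega>. \<beta> (U \<omega>))"
  shows "integrable M (\<lambda>\<omega>. \<beta> (V \<omega>))" "(\<integral>\<omega>. \<beta> (U \<omega>) \<partial>M) = (\<integral>\<omega>. \<beta> (V \<omega>) \<partial>M)"
proof -
  show "integrable M (\<lambda>\<omega>. \<beta> (V \<omega>))"
    using int eq integrable_distr_eq[of U M borel \<beta>] integrable_distr_eq[of V M borel \<beta>] by simp
  show "(\<integral>\<omega>. \<beta> (U \<omega>) \<partial>M) = (\<integral>\<omega>. \<beta> (V \<omega>) \<partial>M)"
    using eq integral_distr[of U M borel \<beta>] integral_distr[of V M borel \<beta>] by simp
qed

section \<open>Stability from dual certificates\<close>

context smooth_convex
begin

lemma borel_measurable_T [measurable]: "T \<in> borel_measurable borel"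
proof (rule borel_measurable_continuous_onI)
  have "lam-lipschitz_on UNIV T"
    using gradient_lipschitz lam_pos by (auto intro!: lipschitz_onI simp: dist_norm)
  then show "continuous_on UNIV T"
    by (rule lipschitz_on_continuous_on)
qed

lemma square_integrable_gradient:
  assumes "finite_measure M" "square_integrable M X"
  shows "square_integrable M (\<lambda>\<omega>. T (X \<omega>))"
proof -
  interpret finite_measure M by fact
  have [measurable]: "X \<in> borel_measurable M"
    using assms by (simp add: square_integrable_def)
  show ?thesis
  proof (rule square_integrable_affine_bound[OF assms(2)])
    show "norm (T (X \<omega>)) \<le> norm (T 0) + lam * norm (X \<omega>)" for \<omega>
      using gradient_lipschitz[of "X \<omega>" 0] norm_triangle_sub[of "T (X \<omega>)" "T 0"] by simp
  qed simp
qed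

lemma integrable_conjugate_gradient:
  assumes "finite_measure M" "square_integrable M X"
  shows "integrable M (\<lambda>\<omega>. enn2real (conjugate (T (X \<omega>))))"
proof -
  interpret finite_measure M by fact
  have [measurable]: "X \<in> borel_measurable M"
    using assms by (simp add: square_integrable_def)
  note sq = square_integrable_gradient[OF assms]
  show ?thesis
  proof (rule Bochner_Integration.integrable_bound)
    show "integrable M (\<lambda>\<omega>. X \<omega> \<bullet> T (X \<omega>) - X \<omega> \<bullet> T 0)"
      by (intro Bochner_Integration.integrable_diff integrable_inner assms(2) sq square_integrable_const)
    show "AE \<omega> in M. norm (enn2real (conjugate (T (X \<omega>)))) \<le> norm (X \<omega> \<bullet> T (X \<omega>) - X \<omega> \<bullet> T 0)"
    proof (rule AE_I2)
      fix \<omega>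
      show "norm (enn2real (conjugate (T (X \<omega>)))) \<le> norm (X \<omega> \<bullet> T (X \<omega>) - X \<omega> \<bullet> T 0)"
        using conjugate_gradient_nonneg[of "X \<omega>"] conjugate_gradient_le[of "X \<omega>"]
        by (simp add: conjugate_real_gradient)
    qed
  qed simp
qed

text \<open>The potential \<open>\<phi>\<close> cancels pointwise, and the conjugate cancels after integration because
  \<open>T X\<close> and \<open>Y\<close> have the same law.\<close>

lemma gradient_stability:
  assumes "finite_measure M" and X: "square_integrable M X" and Y: "square_integrable M Y"
    and law: "distr M borel (\<lambda>\<omega>. T (X \<omega>)) = distr M borel Y"
  shows "(L2_norm M (\<lambda>\<omega>. T (X \<omega>) - Y \<omega>))\<^sup>2
      \<le> lam * ((L2_norm M (\<lambda>\<omega>. X \<omega> - Y \<omega>))\<^sup>2 - (L2_norm M (\<lambda>\<omega>. X \<omega> - T (X \<omega>)))\<^sup>2)"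
proof -
  interpret finite_measure M by fact
  have [measurable]: "X \<in> borel_measurable M" "Y \<in> borel_measurable M"
    using X Y by (simp_all add: square_integrable_def)
  note TX = square_integrable_gradient[OF assms(1) X]
  \<comment> \<open>Adding \<open>\<beta> y\<close> to the squared distance of \<open>x\<close> and
    \<open>y\<close> leaves the squared norm of \<open>x\<close> plus twice the conjugate minus
    \<open>x \<bullet> y\<close>; this turns the Fenchel gap into a statement about quadratic
    costs.\<close>
  define \<beta> where "\<beta> y = 2 * enn2real (conjugate y) - (norm y)\<^sup>2" for y
  have [measurable]: "\<beta> \<in> borel_measurable borel"
    unfolding \<beta>_def by measurable
  have int: "integrable M (\<lambda>\<omega>. \<beta> (T (X \<omega>)))"
    unfolding \<beta>_def using TX integrable_conjugate_gradient[OF assms(1) X]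
    by (auto simp: square_integrable_def)
  note \<beta> = integral_cong_distr[OF law _ _ _ int]
  \<comment> \<open>The conjugate may be infinite off the range of \<open>T\<close>; equality of
    laws carries finiteness from \<open>T (X \<omega>)\<close> over to
    \<open>Y \<omega>\<close>.\<close>
  have fin: "AE \<omega> in M. conjugate (Y \<omega>) < \<top>"
  proof -
    have "AE y in distr M borel (\<lambda>\<omega>. T (X \<omega>)). conjugate y < \<top>"
      by (subst AE_distr_iff) (auto simp: conjugate_gradient)
    then show ?thesis
      unfolding law by (subst (asm) AE_distr_iff) auto
  qed
  have sq: "square_integrable M (\<lambda>\<omega>. T (X \<omega>) - Y \<omega>)" "square_integrable M (\<lambda>\<omega>. X \<omega> - T (X \<omega>))"
    "square_integrable M (\<lambda>\<omega>. X \<omega> - Y \<omega>)"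
    by (intro square_integrable_diff X Y TX)+
  have "(\<integral>\<omega>. (norm (T (X \<omega>) - Y \<omega>))\<^sup>2 / lam + (norm (X \<omega> - T (X \<omega>)))\<^sup>2 + \<beta> (T (X \<omega>)) \<partial>M)
      \<le> (\<integral>\<omega>. (norm (X \<omega> - Y \<omega>))\<^sup>2 + \<beta> (Y \<omega>) \<partial>M)"
  proof (rule integral_mono_AE)
    show "AE \<omega> in M. (norm (T (X \<omega>) - Y \<omega>))\<^sup>2 / lam + (norm (X \<omega> - T (X \<omega>)))\<^sup>2 + \<beta> (T (X \<omega>))
        \<le> (norm (X \<omega> - Y \<omega>))\<^sup>2 + \<beta> (Y \<omega>)"
      using fin
    proof eventually_elim
      case (elim \<omega>)
      have "(norm (X \<omega> - T (X \<omega>)))\<^sup>2 + \<beta> (T (X \<omega>)) = (norm (X \<omega>))\<^sup>2 - 2 * (\<phi> (X \<omega>) - \<phi> 0)"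
        by (simp add: \<beta>_def conjugate_real_gradient power2_norm_eq_inner inner_diff_left
            inner_diff_right inner_commute)
      moreover have "(norm (X \<omega> - Y \<omega>))\<^sup>2 = (norm (X \<omega>))\<^sup>2 + (norm (Y \<omega>))\<^sup>2 - 2 * (X \<omega> \<bullet> Y \<omega>)"
        by (simp add: power2_norm_eq_inner inner_diff_left inner_diff_right inner_commute)
      moreover have "(norm (T (X \<omega>) - Y \<omega>))\<^sup>2 / lam = 2 * ((norm (T (X \<omega>) - Y \<omega>))\<^sup>2 / (2 * lam))"
        by simp
      ultimately show ?case
        using conjugate_gap[OF elim, of "X \<omega>"] by (simp add: \<beta>_def)
    qed
  qed (use sq int \<beta>(1) in \<open>auto simp: square_integrable_def\<close>)
  then have "(L2_norm M (\<lambda>\<omega>. T (X \<omega>) - Y \<omega>))\<^sup>2 / lam + (L2_norm M (\<lambda>\<omega>. X \<omega> - T (X \<omega>)))\<^sup>2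
      \<le> (L2_norm M (\<lambda>\<omega>. X \<omega> - Y \<omega>))\<^sup>2"
    using sq int \<beta> by (simp add: square_integrable_def L2_norm_power2)
  then show ?thesis
    using lam_pos by (simp add: field_simps)
qed

end

text \<open>The discrete conjugate \<open>\<psi>\<close> of the nodal function satisfies a
  Fenchel-Young inequality at every node, with equality when \<open>y\<close> lies in the
  subdifferential of that node. After integration the terms in \<open>\<psi>\<close> cancel because
  \<open>U\<close> and \<open>Y\<close> have the same law, so no such \<open>U\<close> is closer to
  \<open>Z\<close> than \<open>Y\<close> is.\<close>

lemma discrete_subdifferential_optimal:
  fixes \<phi>h :: "'a::euclidean_space \<Rightarrow> real"
  assumes "finite_measure M" and A: "finite A" "A \<noteq> {}"
    and Z: "square_integrable M Z" and Y: "square_integrable M Y" and U: "square_integrable M U"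
    and law: "distr M borel U = distr M borel Y"
    and AE: "AE \<omega> in M. Z \<omega> \<in> A \<and> Y \<omega> \<in> discrete_subdifferential A \<phi>h (Z \<omega>)"
  shows "L2_norm M (\<lambda>\<omega>. Z \<omega> - Y \<omega>) \<le> L2_norm M (\<lambda>\<omega>. Z \<omega> - U \<omega>)"
proof -
  interpret finite_measure M by fact
  have [measurable]: "Z \<in> borel_measurable M" "Y \<in> borel_measurable M" "U \<in> borel_measurable M"
    using Z Y U by (simp_all add: square_integrable_def)
  define \<psi> where "\<psi> y = Max ((\<lambda>q. q \<bullet> y - \<phi>h q) ` A)" for y
  have [measurable]: "\<psi> \<in> borel_measurable borel"
    unfolding \<psi>_def using A by measurable
  have \<psi>_ge: "q \<bullet> y - \<phi>h q \<le> \<psi> y" if "q \<in> A" for q y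
    unfolding \<psi>_def using A that by (intro Max_ge) auto
  have \<psi>_in: "\<exists>q\<in>A. \<psi> y = q \<bullet> y - \<phi>h q" for y
    unfolding \<psi>_def using A Max_in[of "(\<lambda>q. q \<bullet> y - \<phi>h q) ` A"] by fastforce
  have int\<psi>: "integrable M (\<lambda>\<omega>. \<psi> (U \<omega>))"
  proof (rule Bochner_Integration.integrable_bound)
    show "integrable M (\<lambda>\<omega>. \<Sum>q\<in>A. \<bar>q \<bullet> U \<omega> - \<phi>h q\<bar>)"
      by (intro Bochner_Integration.integrable_sum integrable_abs Bochner_Integration.integrable_diff
          integrable_inner square_integrable_const U) simp
    show "AE \<omega> in M. norm (\<psi> (U \<omega>)) \<le> norm (\<Sum>q\<in>A. \<bar>q \<bullet> U \<omega> - \<phi>h q\<bar>)"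
    proof (rule AE_I2)
      fix \<omega>
      obtain q where q: "q \<in> A" "\<psi> (U \<omega>) = q \<bullet> U \<omega> - \<phi>h q"
        using \<psi>_in by blast
      have "\<bar>q \<bullet> U \<omega> - \<phi>h q\<bar> \<le> (\<Sum>q\<in>A. \<bar>q \<bullet> U \<omega> - \<phi>h q\<bar>)"
        using q A by (intro member_le_sum) auto
      then show "norm (\<psi> (U \<omega>)) \<le> norm (\<Sum>q\<in>A. \<bar>q \<bullet> U \<omega> - \<phi>h q\<bar>)"
        using q by simp
    qed
  qed simp
  define \<beta> where "\<beta> y = 2 * \<psi> y - (norm y)\<^sup>2" for y
  have [measurable]: "\<beta> \<in> borel_measurable borel"
    unfolding \<beta>_def by measurable
  have int: "integrable M (\<lambda>\<omega>. \<beta> (U \<omega>))"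
    unfolding \<beta>_def using U int\<psi> by (auto simp: square_integrable_def)
  note \<beta> = integral_cong_distr[OF law _ _ _ int]
  have sq: "square_integrable M (\<lambda>\<omega>. Z \<omega> - Y \<omega>)" "square_integrable M (\<lambda>\<omega>. Z \<omega> - U \<omega>)"
    by (intro square_integrable_diff Z Y U)+
  have expand: "(norm (z - y))\<^sup>2 + \<beta> y = (norm z)\<^sup>2 - 2 * (z \<bullet> y - \<psi> y)" for z y
    by (simp add: \<beta>_def power2_norm_eq_inner inner_diff_left inner_diff_right inner_commute)
  have "(\<integral>\<omega>. (norm (Z \<omega> - Y \<omega>))\<^sup>2 + \<beta> (Y \<omega>) \<partial>M) \<le> (\<integral>\<omega>. (norm (Z \<omega> - U \<omega>))\<^sup>2 + \<beta> (U \<omega>) \<partial>M)"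
  proof (rule integral_mono_AE)
    show "AE \<omega> in M. (norm (Z \<omega> - Y \<omega>))\<^sup>2 + \<beta> (Y \<omega>) \<le> (norm (Z \<omega> - U \<omega>))\<^sup>2 + \<beta> (U \<omega>)"
      using AE
    proof eventually_elim
      case (elim \<omega>)
      obtain q where q: "q \<in> A" "\<psi> (Y \<omega>) = q \<bullet> Y \<omega> - \<phi>h q"
        using \<psi>_in by blast
      then have "\<psi> (Y \<omega>) \<le> Z \<omega> \<bullet> Y \<omega> - \<phi>h (Z \<omega>)"
        using elim by (auto simp: discrete_subdifferential_def inner_diff_left)
      moreover have "Z \<omega> \<bullet> U \<omega> - \<phi>h (Z \<omega>) \<le> \<psi> (U \<omega>)"
        using \<psi>_ge elim by blast
      ultimately show ?case
        unfolding expand by simp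
    qed
  qed (use sq int \<beta>(1) in \<open>auto simp: square_integrable_def\<close>)
  then have "(L2_norm M (\<lambda>\<omega>. Z \<omega> - Y \<omega>))\<^sup>2 \<le> (L2_norm M (\<lambda>\<omega>. Z \<omega> - U \<omega>))\<^sup>2"
    using sq int \<beta> by (simp add: square_integrable_def L2_norm_power2)
  then show ?thesis
    by (rule power2_le_imp_le) simp
qed

section \<open>Couplings and the Wasserstein distance\<close>

lemma P2_D:
  assumes "\<mu> \<in> P2"
  shows "prob_space \<mu>" "sets \<mu> = sets borel" "space \<mu> = UNIV" "integrable \<mu> (\<lambda>x. (norm x)\<^sup>2)"
  using assms by (auto simp: P2_def dest: sets_eq_imp_space_eq)

lemma discrete_measure_P2:
  assumes "prob_space (discrete_measure N x w)"
  shows "discrete_measure N x w \<in> P2"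
proof -
  let ?P = "point_measure {1..N} (\<lambda>i. ennreal (w i))"
  have [measurable]: "x \<in> measurable ?P borel"
    by (simp add: measurable_point_measure_eq1)
  have "integrable ?P (\<lambda>i. (norm (x i))\<^sup>2)"
    by (rule integrable_point_measure_finite) simp
  then have "integrable (discrete_measure N x w) (\<lambda>x. (norm x)\<^sup>2)"
    unfolding discrete_measure_def by (subst integrable_distr_eq) auto
  then show ?thesis
    using assms by (simp add: P2_def discrete_measure_def)
qed

lemma couplings_D:
  assumes "\<gamma> \<in> couplings \<mu> \<nu>"
  shows "sets \<gamma> = sets borel" "distr \<gamma> borel fst = \<mu>" "distr \<gamma> borel snd = \<nu>"
    "fst \<in> borel_measurable \<gamma>" "snd \<in> borel_measurable \<gamma>"
proof -
  show "sets \<gamma> = sets borel" "distr \<gamma> borel fst = \<mu>" "distr \<gamma> borel snd = \<nu>"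
    using assms by (auto simp: couplings_def)
  then show "fst \<in> borel_measurable \<gamma>" "snd \<in> borel_measurable \<gamma>"
    by (auto simp: measurable_cong_sets[of \<gamma> borel]
        intro!: borel_measurable_continuous_onI continuous_on_fst continuous_on_snd continuous_on_id)
qed

lemma couplings_prob_space:
  fixes \<mu> :: "'a::euclidean_space measure"
  assumes "\<gamma> \<in> couplings \<mu> \<nu>" "prob_space \<mu>"
  shows "prob_space \<gamma>"
  using prob_space_distrD[of fst \<gamma> borel] couplings_D(2,4)[OF assms(1)] assms(2) by argo

lemma square_integrable_distr:
  assumes "distr M borel X \<in> P2" "X \<in> borel_measurable M"
  shows "square_integrable M X"
  using P2_D(4)[OF assms(1)] assms(2) by (simp add: square_integrable_def integrable_distr_eq)

lemma couplings_square_integrable: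
  assumes "\<gamma> \<in> couplings \<mu> \<nu>" "\<mu> \<in> P2" "\<nu> \<in> P2"
  shows "square_integrable \<gamma> fst" "square_integrable \<gamma> snd"
  using assms(2,3) couplings_D[OF assms(1)] by (simp_all add: square_integrable_distr)

lemma nn_integral_norm_power2:
  assumes "square_integrable M u"
  shows "(\<integral>\<^sup>+\<omega>. ennreal ((norm (u \<omega>))\<^sup>2) \<partial>M) = ennreal ((L2_norm M u)\<^sup>2)"
  using assms unfolding L2_norm_power2
  by (intro nn_integral_eq_integral) (auto simp: square_integrable_def)

text \<open>The independent coupling; its cost is finite, which bounds the infimum in
  \<open>W2\<close>.\<close>

lemma couplings_pair_measure:
  assumes "\<mu> \<in> P2" "\<nu> \<in> P2"
  shows "\<mu> \<Otimes>\<^sub>M \<nu> \<in> couplings \<mu> \<nu>"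
proof -
  note \<mu> = P2_D[OF assms(1)] and \<nu> = P2_D[OF assms(2)]
  interpret \<mu>: prob_space \<mu> by fact
  interpret \<nu>: prob_space \<nu> by fact
  interpret pair_prob_space \<mu> \<nu> ..
  have "sets (\<mu> \<Otimes>\<^sub>M \<nu>) = sets borel"
    using sets_pair_measure_cong[OF \<mu>(2) \<nu>(2)] unfolding borel_prod .
  moreover have "distr (\<mu> \<Otimes>\<^sub>M \<nu>) borel fst = \<mu>"
    using \<nu>.distr_pair_fst[of \<mu>] distr_cong[OF refl \<mu>(2)[symmetric], of "\<mu> \<Otimes>\<^sub>M \<nu>" fst fst] by simp
  moreover have "distr (\<mu> \<Otimes>\<^sub>M \<nu>) borel snd = \<nu>"
  proof (rule measure_eqI)
    fix A assume "A \<in> sets (distr (\<mu> \<Otimes>\<^sub>M \<nu>) borel snd)"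
    then have A: "A \<in> sets \<nu>" using \<nu> by simp
    have "snd \<in> borel_measurable (\<mu> \<Otimes>\<^sub>M \<nu>)"
      using measurable_cong_sets[OF refl \<nu>(2), of "\<mu> \<Otimes>\<^sub>M \<nu>"] measurable_snd by blast
    moreover have "snd -` A \<inter> space (\<mu> \<Otimes>\<^sub>M \<nu>) = space \<mu> \<times> A"
      using \<mu>(3) \<nu>(3) by (auto simp: space_pair_measure)
    ultimately have "emeasure (distr (\<mu> \<Otimes>\<^sub>M \<nu>) borel snd) A = emeasure (\<mu> \<Otimes>\<^sub>M \<nu>) (space \<mu> \<times> A)"
      using A \<nu>(2) by (simp add: emeasure_distr)
    also have "\<dots> = emeasure \<nu> A"
      using A by (simp add: \<nu>.emeasure_pair_measure_Times \<mu>.emeasure_space_1)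
    finally show "emeasure (distr (\<mu> \<Otimes>\<^sub>M \<nu>) borel snd) A = emeasure \<nu> A" .
  qed (use \<nu> in simp)
  ultimately show ?thesis
    by (simp add: couplings_def)
qed

lemma couplings_cost:
  assumes "\<gamma> \<in> couplings \<mu> \<nu>" "\<mu> \<in> P2" "\<nu> \<in> P2"
  shows "(\<integral>\<^sup>+p. ennreal ((norm (fst p - snd p))\<^sup>2) \<partial>\<gamma>) = ennreal ((L2_norm \<gamma> (\<lambda>p. fst p - snd p))\<^sup>2)"
  by (intro nn_integral_norm_power2 square_integrable_diff couplings_square_integrable[OF assms])

lemma W2_nonneg: "0 \<le> W2 \<mu> \<nu>"
  by (simp add: W2_def)

text \<open>The infimum is finite, so \<open>enn2real\<close> in \<open>W2\<close> does not collapse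
  an infinite value to zero.\<close>

lemma ennreal_W2_power2:
  assumes "\<mu> \<in> P2" "\<nu> \<in> P2"
  shows "ennreal ((W2 \<mu> \<nu>)\<^sup>2) = (INF \<gamma>\<in>couplings \<mu> \<nu>. \<integral>\<^sup>+p. ennreal ((norm (fst p - snd p))\<^sup>2) \<partial>\<gamma>)"
proof -
  note \<gamma> = couplings_pair_measure[OF assms]
  have "(INF \<gamma>\<in>couplings \<mu> \<nu>. \<integral>\<^sup>+p. ennreal ((norm (fst p - snd p))\<^sup>2) \<partial>\<gamma>)
      \<le> (\<integral>\<^sup>+p. ennreal ((norm (fst p - snd p))\<^sup>2) \<partial>(\<mu> \<Otimes>\<^sub>M \<nu>))"
    by (rule INF_lower[OF \<gamma>])
  also have "\<dots> < \<top>"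
    by (simp add: couplings_cost[OF \<gamma> assms])
  finally show ?thesis
    by (simp add: W2_def)
qed

lemma W2_near_optimal_coupling:
  assumes "\<mu> \<in> P2" "\<nu> \<in> P2" "0 < e"
  obtains \<gamma> where "\<gamma> \<in> couplings \<mu> \<nu>" "L2_norm \<gamma> (\<lambda>p. fst p - snd p) \<le> W2 \<mu> \<nu> + e"
proof -
  have "ennreal ((W2 \<mu> \<nu>)\<^sup>2) < ennreal ((W2 \<mu> \<nu> + e)\<^sup>2)"
    using assms(3) W2_nonneg[of \<mu> \<nu>] by (simp add: ennreal_less_iff power_strict_mono)
  then obtain \<gamma> where \<gamma>: "\<gamma> \<in> couplings \<mu> \<nu>"
    "(\<integral>\<^sup>+p. ennreal ((norm (fst p - snd p))\<^sup>2) \<partial>\<gamma>) < ennreal ((W2 \<mu> \<nu> + e)\<^sup>2)"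
    unfolding ennreal_W2_power2[OF assms(1,2)] INF_less_iff by blast
  have "(L2_norm \<gamma> (\<lambda>p. fst p - snd p))\<^sup>2 \<le> (W2 \<mu> \<nu> + e)\<^sup>2"
    using \<gamma>(2) unfolding couplings_cost[OF \<gamma>(1) assms(1,2)]
    by (simp only: ennreal_less_iff zero_le_power2 less_imp_le)
  then have "L2_norm \<gamma> (\<lambda>p. fst p - snd p) \<le> W2 \<mu> \<nu> + e"
    by (rule power2_le_imp_le) (use W2_nonneg[of \<mu> \<nu>] assms(3) in simp)
  with \<gamma>(1) show thesis
    by (rule that)
qed

lemma distr_comp_eq:
  assumes "distr M borel X = \<mu>" "distr \<mu> borel T = \<nu>"
    and "X \<in> borel_measurable M" "T \<in> borel_measurable borel"
  shows "distr M borel (\<lambda>\<omega>. T (X \<omega>)) = \<nu>"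
  using distr_distr[OF assms(4,3)] unfolding assms(1,2) by (simp add: comp_def)

text \<open>Applied to the two coordinates of any plan, \<open>gradient_stability\<close> has a
  nonnegative left-hand side, so no plan is cheaper than the map. This passes from competition among
  maps to competition among plans.\<close>

lemma (in smooth_convex) gradient_cost_le_W2:
  assumes \<mu>: "\<mu> \<in> P2" and \<nu>: "\<nu> \<in> P2" and T: "distr \<mu> borel T = \<nu>"
  shows "L2_norm \<mu> (\<lambda>x. x - T x) \<le> W2 \<mu> \<nu>"
proof (rule power2_le_imp_le)
  have "ennreal ((L2_norm \<mu> (\<lambda>x. x - T x))\<^sup>2)
      \<le> (INF \<gamma>\<in>couplings \<mu> \<nu>. \<integral>\<^sup>+p. ennreal ((norm (fst p - snd p))\<^sup>2) \<partial>\<gamma>)"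
  proof (rule INF_greatest)
    fix \<gamma> assume \<gamma>: "\<gamma> \<in> couplings \<mu> \<nu>"
    note D = couplings_D[OF \<gamma>]
    interpret prob_space \<gamma>
      using couplings_prob_space[OF \<gamma>] P2_D(1)[OF \<mu>] by simp
    have "distr \<gamma> borel (\<lambda>p. T (fst p)) = distr \<gamma> borel snd"
      using distr_comp_eq[OF D(2) T D(4)] D(3) by simp
    from gradient_stability[OF finite_measure_axioms couplings_square_integrable[OF \<gamma> \<mu> \<nu>] this]
    have "0 \<le> lam * ((L2_norm \<gamma> (\<lambda>p. fst p - snd p))\<^sup>2 - (L2_norm \<gamma> (\<lambda>p. fst p - T (fst p)))\<^sup>2)"
      by (rule order_trans[rotated]) simp
    then have "(L2_norm \<gamma> (\<lambda>p. fst p - T (fst p)))\<^sup>2 \<le> (L2_norm \<gamma> (\<lambda>p. fst p - snd p))\<^sup>2"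
      using lam_pos by (simp add: zero_le_mult_iff)
    also have "(L2_norm \<gamma> (\<lambda>p. fst p - T (fst p)))\<^sup>2 = (L2_norm \<mu> (\<lambda>x. x - T x))\<^sup>2"
      unfolding L2_norm_power2 D(2)[symmetric] using D(4) by (subst integral_distr) auto
    finally show "ennreal ((L2_norm \<mu> (\<lambda>x. x - T x))\<^sup>2)
        \<le> (\<integral>\<^sup>+p. ennreal ((norm (fst p - snd p))\<^sup>2) \<partial>\<gamma>)"
      unfolding couplings_cost[OF \<gamma> \<mu> \<nu>] by (rule ennreal_leI)
  qed
  then show "(L2_norm \<mu> (\<lambda>x. x - T x))\<^sup>2 \<le> (W2 \<mu> \<nu>)\<^sup>2"
    unfolding ennreal_W2_power2[OF \<mu> \<nu>, symmetric] by simp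
qed (rule W2_nonneg)

section \<open>Gluing a plan with discrete second marginal to a family of cells\<close>

lemma emeasure_distr_nn_integral:
  assumes "f \<in> measurable M N" "A \<in> sets N"
  shows "emeasure (distr M N f) A = (\<integral>\<^sup>+\<omega>. indicator A (f \<omega>) \<partial>M)"
proof -
  have "emeasure (distr M N f) A = (\<integral>\<^sup>+y. indicator A y \<partial>distr M N f)"
    using assms by simp
  also have "\<dots> = (\<integral>\<^sup>+\<omega>. indicator A (f \<omega>) \<partial>M)"
    using assms by (intro nn_integral_distr) auto
  finally show ?thesis .
qed

text \<open>The number of cells containing \<open>y\<close> is at least one almost everywhere and
  has integral one, hence equals one almost everywhere. Overlaps of cells are thus null by counting
  mass, without studying their boundaries.\<close>

lemma AE_sum_indicator_eq_1:
  assumes "prob_space \<nu>" and [measurable]: "\<And>i. i \<in> I \<Longrightarrow> F i \<in> sets \<nu>"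
    and "finite I" and total: "(\<Sum>i\<in>I. emeasure \<nu> (F i)) = 1"
    and cover: "AE y in \<nu>. \<exists>i\<in>I. y \<in> F i"
  shows "AE y in \<nu>. (\<Sum>i\<in>I. indicator (F i) y) = (1::ennreal)"
proof -
  interpret prob_space \<nu> by fact
  define k where "k y = (\<Sum>i\<in>I. indicator (F i) y :: ennreal)" for y
  have [measurable]: "k \<in> borel_measurable \<nu>"
    unfolding k_def by measurable
  have ge: "AE y in \<nu>. 1 \<le> k y"
    using cover
  proof eventually_elim
    case (elim y)
    then obtain i where "i \<in> I" "y \<in> F i" by blast
    then have "indicator (F i) y \<le> k y"
      unfolding k_def using assms(3) by (intro member_le_sum) auto
    then show ?case using \<open>y \<in> F i\<close> by simp
  qed
  have "(\<integral>\<^sup>+y. k y \<partial>\<nu>) = 1"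
    unfolding k_def using assms(2,3) total by (simp add: nn_integral_sum)
  then have "(\<integral>\<^sup>+y. k y - 1 \<partial>\<nu>) = 0"
    using ge by (subst nn_integral_diff) (auto simp: emeasure_space_1)
  then have "AE y in \<nu>. k y - 1 = 0"
    by (subst (asm) nn_integral_0_iff_AE) auto
  with ge show ?thesis
    unfolding k_def[symmetric]
  proof eventually_elim
    case (elim y)
    then have "k y \<le> 1"
      by (metis diff_add_cancel_ennreal add_0 order_refl)
    with elim show ?case by simp
  qed
qed

text \<open>No disintegration is needed to glue a plan \<open>\<pi>\<close> with discrete second marginal to a partition
  of \<open>\<nu>\<close>: the glued measure has a density with respect to \<open>\<pi> \<Otimes>\<^sub>M \<nu>\<close>.\<close>

locale semidiscrete_gluing =
  fixes \<pi> :: "('a::euclidean_space \<times> 'a) measure" and \<nu> :: "'a measure"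
    and I :: "nat set" and x :: "nat \<Rightarrow> 'a" and w :: "nat \<Rightarrow> real" and F :: "nat \<Rightarrow> 'a set"
  assumes prob_\<pi>: "prob_space \<pi>" and prob_\<nu>: "prob_space \<nu>"
    and sets_\<pi> [measurable_cong]: "sets \<pi> = sets (borel \<Otimes>\<^sub>M borel)"
    and sets_\<nu> [measurable_cong]: "sets \<nu> = sets borel"
    and I: "finite I"
    and w_pos: "i \<in> I \<Longrightarrow> 0 < w i"
    and F [measurable]: "i \<in> I \<Longrightarrow> F i \<in> sets borel"
    and inj: "inj_on x I"
    and \<pi>_nodes: "i \<in> I \<Longrightarrow> emeasure (distr \<pi> borel snd) {x i} = ennreal (w i)"
    and AE_nodes: "AE z in distr \<pi> borel snd. z \<in> x ` I"
    and \<nu>_cells: "i \<in> I \<Longrightarrow> emeasure \<nu> (F i) = ennreal (w i)"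
    and AE_cells: "AE y in \<nu>. \<exists>i\<in>I. y \<in> F i"
begin

sublocale \<pi>: prob_space \<pi> by (fact prob_\<pi>)
sublocale \<nu>: prob_space \<nu> by (fact prob_\<nu>)

text \<open>Given that the second point is \<open>x i\<close>, the third is drawn from \<nu>
  restricted to \<open>F i\<close> and normalised by its mass \<open>w i\<close>.\<close>

definition kernel :: "('a \<times> 'a) \<times> 'a \<Rightarrow> ennreal" where
  "kernel q = (\<Sum>i\<in>I. ennreal (1 / w i) * (indicator {x i} (snd (fst q)) * indicator (F i) (snd q)))"

definition glued :: "(('a \<times> 'a) \<times> 'a) measure" where
  "glued = density (\<pi> \<Otimes>\<^sub>M \<nu>) kernel"

lemma borel_measurable_kernel [measurable]: "kernel \<in> borel_measurable (\<pi> \<Otimes>\<^sub>M \<nu>)"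
  unfolding kernel_def by measurable

lemma sets_glued [measurable_cong]: "sets glued = sets (\<pi> \<Otimes>\<^sub>M \<nu>)"
  by (simp add: glued_def)

lemma measurable_coordinates:
  "(\<lambda>q. fst (fst q)) \<in> borel_measurable glued" "(\<lambda>q. snd (fst q)) \<in> borel_measurable glued"
  "snd \<in> borel_measurable glued" "fst \<in> measurable glued \<pi>"
  by measurable

lemma nn_integral_glued:
  assumes [measurable]: "h \<in> borel_measurable (\<pi> \<Otimes>\<^sub>M \<nu>)"
  shows "(\<integral>\<^sup>+q. h q \<partial>glued) = (\<Sum>i\<in>I. ennreal (1 / w i) *
    (\<integral>\<^sup>+p. indicator {x i} (snd p) * (\<integral>\<^sup>+y. indicator (F i) y * h (p, y) \<partial>\<nu>) \<partial>\<pi>))"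
proof -
  have "(\<integral>\<^sup>+q. h q \<partial>glued) = (\<integral>\<^sup>+q. kernel q * h q \<partial>(\<pi> \<Otimes>\<^sub>M \<nu>))"
    unfolding glued_def by (rule nn_integral_density) measurable
  also have "\<dots> = (\<integral>\<^sup>+p. \<integral>\<^sup>+y. kernel (p, y) * h (p, y) \<partial>\<nu> \<partial>\<pi>)"
    by (rule \<nu>.nn_integral_fst[symmetric]) measurable
  also have "\<dots> = (\<integral>\<^sup>+p. (\<Sum>i\<in>I. ennreal (1 / w i) *
      (indicator {x i} (snd p) * (\<integral>\<^sup>+y. indicator (F i) y * h (p, y) \<partial>\<nu>))) \<partial>\<pi>)"
  proof (rule nn_integral_cong)
    fix p assume [measurable]: "p \<in> space \<pi>"
    have [measurable]: "(\<lambda>y. h (p, y)) \<in> borel_measurable \<nu>"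
      by measurable
    have "(\<integral>\<^sup>+y. kernel (p, y) * h (p, y) \<partial>\<nu>)
        = (\<integral>\<^sup>+y. (\<Sum>i\<in>I. ennreal (1 / w i) * (indicator {x i} (snd p) * (indicator (F i) y * h (p, y)))) \<partial>\<nu>)"
      by (intro nn_integral_cong) (simp add: kernel_def sum_distrib_right mult.assoc)
    also have "\<dots> = (\<Sum>i\<in>I. \<integral>\<^sup>+y. ennreal (1 / w i) * (indicator {x i} (snd p) * (indicator (F i) y * h (p, y))) \<partial>\<nu>)"
      by (rule nn_integral_sum) measurable
    also have "\<dots> = (\<Sum>i\<in>I. ennreal (1 / w i) *
      (indicator {x i} (snd p) * (\<integral>\<^sup>+y. indicator (F i) y * h (p, y) \<partial>\<nu>)))"
      by (intro sum.cong refl) (simp add: nn_integral_cmult)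
    finally show "(\<integral>\<^sup>+y. kernel (p, y) * h (p, y) \<partial>\<nu>) = \<dots>" .
  qed
  also have "\<dots> = (\<Sum>i\<in>I. \<integral>\<^sup>+p. ennreal (1 / w i) *
      (indicator {x i} (snd p) * (\<integral>\<^sup>+y. indicator (F i) y * h (p, y) \<partial>\<nu>)) \<partial>\<pi>)"
    by (rule nn_integral_sum) measurable
  also have "\<dots> = (\<Sum>i\<in>I. ennreal (1 / w i) *
    (\<integral>\<^sup>+p. indicator {x i} (snd p) * (\<integral>\<^sup>+y. indicator (F i) y * h (p, y) \<partial>\<nu>) \<partial>\<pi>))"
    by (intro sum.cong refl nn_integral_cmult) measurable
  finally show ?thesis .
qed

lemma inverse_weight: "i \<in> I \<Longrightarrow> ennreal (1 / w i) * ennreal (w i) = 1"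
  using w_pos[of i] by (simp add: ennreal_mult'[symmetric])

text \<open>The mass \<open>w i\<close> of the node cancels the factor \<open>1 / w i\<close>: the
  joint law of the last two points is the sum over \<open>i\<close> of the point mass at
  \<open>x i\<close> times \<nu> restricted to \<open>F i\<close>.\<close>

lemma nn_integral_glued_snd:
  assumes [measurable]: "u \<in> borel_measurable (borel \<Otimes>\<^sub>M borel)"
  shows "(\<integral>\<^sup>+q. u (snd (fst q), snd q) \<partial>glued) = (\<Sum>i\<in>I. \<integral>\<^sup>+y. indicator (F i) y * u (x i, y) \<partial>\<nu>)"
proof -
  have "ennreal (1 / w i) *
      (\<integral>\<^sup>+p. indicator {x i} (snd p) * (\<integral>\<^sup>+y. indicator (F i) y * u (snd p, y) \<partial>\<nu>) \<partial>\<pi>)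
      = (\<integral>\<^sup>+y. indicator (F i) y * u (x i, y) \<partial>\<nu>)" if i: "i \<in> I" for i
  proof -
    let ?c = "\<integral>\<^sup>+y. indicator (F i) y * u (x i, y) \<partial>\<nu>"
    have "(\<integral>\<^sup>+p. indicator {x i} (snd p) * (\<integral>\<^sup>+y. indicator (F i) y * u (snd p, y) \<partial>\<nu>) \<partial>\<pi>)
        = (\<integral>\<^sup>+p. indicator {x i} (snd p) * ?c \<partial>\<pi>)"
      by (intro nn_integral_cong) (simp split: split_indicator)
    also have "\<dots> = (\<integral>\<^sup>+p. indicator {x i} (snd p) \<partial>\<pi>) * ?c"
      by (rule nn_integral_multc) measurable
    also have "(\<integral>\<^sup>+p. indicator {x i} (snd p) \<partial>\<pi>) = emeasure (distr \<pi> borel snd) {x i}"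
      by (subst emeasure_distr_nn_integral) auto
    finally show ?thesis
      using i by (simp add: \<pi>_nodes mult.assoc[symmetric] inverse_weight)
  qed
  then show ?thesis
    by (subst nn_integral_glued) auto
qed

text \<open>Integrating the kernel over the third point gives one over each node, since
  \<open>F i\<close> has mass \<open>w i\<close>, and by injectivity almost every pair lies over
  exactly one node.\<close>

lemma distr_glued_fst: "distr glued \<pi> fst = \<pi>"
proof (rule measure_eqI)
  fix A assume "A \<in> sets (distr glued \<pi> fst)"
  then have A [measurable]: "A \<in> sets \<pi>" by simp
  have [measurable]: "(\<lambda>q. indicator A (fst q) :: ennreal) \<in> borel_measurable (\<pi> \<Otimes>\<^sub>M \<nu>)"
    by measurable
  have "emeasure (distr glued \<pi> fst) A = (\<integral>\<^sup>+q. indicator A (fst q) \<partial>glued)"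
    by (rule emeasure_distr_nn_integral) auto
  also have "\<dots> = (\<Sum>i\<in>I. ennreal (1 / w i) *
      (\<integral>\<^sup>+p. indicator {x i} (snd p) * (\<integral>\<^sup>+y. indicator (F i) y * indicator A p \<partial>\<nu>) \<partial>\<pi>))"
    by (subst nn_integral_glued) auto
  also have "\<dots> = (\<Sum>i\<in>I. \<integral>\<^sup>+p. indicator {x i} (snd p) * indicator A p \<partial>\<pi>)"
  proof (rule sum.cong[OF refl])
    fix i assume i: "i \<in> I"
    have "(\<integral>\<^sup>+y. indicator (F i) y * indicator A p \<partial>\<nu>) = ennreal (w i) * indicator A p" for p
      using i by (subst nn_integral_multc) (auto simp: sets_\<nu> \<nu>_cells)
    then have "(\<integral>\<^sup>+p. indicator {x i} (snd p) * (\<integral>\<^sup>+y. indicator (F i) y * indicator A p \<partial>\<nu>) \<partial>\<pi>)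
        = (\<integral>\<^sup>+p. ennreal (w i) * (indicator {x i} (snd p) * indicator A p) \<partial>\<pi>)"
      using i by (intro nn_integral_cong) (simp add: mult_ac)
    also have "\<dots> = ennreal (w i) * (\<integral>\<^sup>+p. indicator {x i} (snd p) * indicator A p \<partial>\<pi>)"
      by (rule nn_integral_cmult) measurable
    finally show "ennreal (1 / w i) *
        (\<integral>\<^sup>+p. indicator {x i} (snd p) * (\<integral>\<^sup>+y. indicator (F i) y * indicator A p \<partial>\<nu>) \<partial>\<pi>)
        = (\<integral>\<^sup>+p. indicator {x i} (snd p) * indicator A p \<partial>\<pi>)"
      using i by (simp add: mult.assoc[symmetric] inverse_weight)
  qed
  also have "\<dots> = (\<integral>\<^sup>+p. (\<Sum>i\<in>I. indicator {x i} (snd p) * indicator A p) \<partial>\<pi>)"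
    by (rule nn_integral_sum[symmetric]) measurable
  also have "\<dots> = (\<integral>\<^sup>+p. indicator A p \<partial>\<pi>)"
  proof (rule nn_integral_cong_AE)
    have "AE p in \<pi>. snd p \<in> x ` I"
      using AE_nodes I by (subst (asm) AE_distr_iff) (auto simp: finite_imp_closed intro!: borel_closed)
    then show "AE p in \<pi>. (\<Sum>i\<in>I. indicator {x i} (snd p) * indicator A p) = (indicator A p :: ennreal)"
    proof eventually_elim
      case (elim p)
      then obtain j where j: "j \<in> I" "snd p = x j" by blast
      have "(\<Sum>i\<in>I. indicator {x i} (snd p) :: ennreal) = (\<Sum>i\<in>I. if i = j then 1 else 0)"
        using j inj by (intro sum.cong) (auto simp: inj_on_def indicator_def)
      also have "\<dots> = 1"
        using j I by simp
      finally show ?case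
        by (simp add: sum_distrib_right[symmetric])
    qed
  qed
  also have "\<dots> = emeasure \<pi> A"
    by (rule nn_integral_indicator) fact
  finally show "emeasure (distr glued \<pi> fst) A = emeasure \<pi> A" .
qed simp

lemma distr_glued_snd: "distr glued borel snd = \<nu>"
proof (rule measure_eqI)
  fix B :: "'a set" assume "B \<in> sets (distr glued borel snd)"
  then have B [measurable]: "B \<in> sets borel" by simp
  \<comment> \<open>The second marginal of \<pi> is a probability measure carried by the nodes, and
    the cells have the same masses as the nodes.\<close>
  have total: "(\<Sum>i\<in>I. emeasure \<nu> (F i)) = 1"
  proof -
    have "(\<Sum>i\<in>I. emeasure (distr \<pi> borel snd) {x i}) = (\<Sum>z\<in>x ` I. emeasure (distr \<pi> borel snd) {z})"
      using inj by (simp add: sum.reindex)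
    also have "\<dots> = emeasure (distr \<pi> borel snd) (x ` I)"
      using I by (intro emeasure_eq_sum_singleton[symmetric]) auto
    also have "\<dots> = 1"
    proof -
      interpret d: prob_space "distr \<pi> borel snd"
        by (rule \<pi>.prob_space_distr) measurable
      show ?thesis
        using d.emeasure_eq_1_AE[OF _ AE_nodes] I by (simp add: finite_imp_closed borel_closed)
    qed
    finally show ?thesis
      by (simp add: \<pi>_nodes \<nu>_cells)
  qed
  have "emeasure (distr glued borel snd) B = (\<integral>\<^sup>+q. indicator B (snd q) \<partial>glued)"
    by (rule emeasure_distr_nn_integral) auto
  also have "\<dots> = (\<Sum>i\<in>I. \<integral>\<^sup>+y. indicator (F i) y * indicator B y \<partial>\<nu>)"
    using nn_integral_glued_snd[of "\<lambda>q. indicator B (snd q)"] by simp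
  also have "\<dots> = (\<integral>\<^sup>+y. (\<Sum>i\<in>I. indicator (F i) y * indicator B y) \<partial>\<nu>)"
    by (rule nn_integral_sum[symmetric]) measurable
  also have "\<dots> = (\<integral>\<^sup>+y. indicator B y \<partial>\<nu>)"
  proof (rule nn_integral_cong_AE)
    have "AE y in \<nu>. (\<Sum>i\<in>I. indicator (F i) y) = (1::ennreal)"
      using AE_sum_indicator_eq_1[OF prob_\<nu> _ I total AE_cells] by (simp add: sets_\<nu>)
    then show "AE y in \<nu>. (\<Sum>i\<in>I. indicator (F i) y * indicator B y) = (indicator B y :: ennreal)"
      by eventually_elim (simp add: sum_distrib_right[symmetric])
  qed
  also have "\<dots> = emeasure \<nu> B"
    by (rule nn_integral_indicator) (simp add: sets_\<nu>)
  finally show "emeasure (distr glued borel snd) B = emeasure \<nu> B" .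
qed (simp add: sets_\<nu>)

lemma prob_space_glued: "prob_space glued"
  using prob_space_distrD[of fst glued \<pi>] distr_glued_fst prob_\<pi> by simp

lemma AE_glued: "AE q in glued. \<exists>i\<in>I. snd (fst q) = x i \<and> snd q \<in> F i"
  unfolding glued_def
proof (subst AE_density)
  show "AE q in \<pi> \<Otimes>\<^sub>M \<nu>. 0 < kernel q \<longrightarrow> (\<exists>i\<in>I. snd (fst q) = x i \<and> snd q \<in> F i)"
  proof (intro AE_I2 impI)
    fix q assume "0 < kernel q"
    then have "\<exists>i\<in>I. ennreal (1 / w i) * (indicator {x i} (snd (fst q)) * indicator (F i) (snd q)) \<noteq> 0"
      unfolding kernel_def using sum.neutral by (metis (no_types, lifting) less_irrefl)
    then show "\<exists>i\<in>I. snd (fst q) = x i \<and> snd q \<in> F i"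
      by (auto simp: indicator_def split: if_splits)
  qed
qed measurable

end

section \<open>Second moments of convex cells\<close>

text \<open>Change of variables to the midpoint of \<open>a\<close> and \<open>u\<close>, with
  Jacobian \<open>(1 / 2) ^ DIM('a)\<close>; convexity keeps the midpoint in
  \<open>F\<close>.\<close>

lemma nn_integral_lborel_half_shrink:
  fixes F :: "'a::euclidean_space set" and f :: "'a \<Rightarrow> ennreal"
  assumes F: "convex F" "a \<in> F" and [measurable]: "F \<in> sets borel" "f \<in> borel_measurable borel"
  shows "ennreal ((1 / 2) ^ DIM('a)) * (\<integral>\<^sup>+u. indicator F u * f ((1 / 2) *\<^sub>R a + (1 / 2) *\<^sub>R u) \<partial>lborel)
      \<le> (\<integral>\<^sup>+y. indicator F y * f y \<partial>lborel)"
proof -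
  let ?s = "\<lambda>u. (1 / 2) *\<^sub>R a + (1 / 2) *\<^sub>R u"
  have [measurable]: "?s \<in> borel_measurable borel"
    by measurable
  have "(\<integral>\<^sup>+y. indicator F y * f y \<partial>lborel)
      = (\<integral>\<^sup>+y. indicator F y * f y \<partial>density (distr lborel borel ?s) (\<lambda>_. ennreal (\<bar>1 / 2\<bar> ^ DIM('a))))"
    using lborel_affine[of "1 / 2" "(1 / 2) *\<^sub>R a"] by simp
  also have "\<dots> = ennreal ((1 / 2) ^ DIM('a)) * (\<integral>\<^sup>+u. indicator F (?s u) * f (?s u) \<partial>lborel)"
    by (simp add: nn_integral_density nn_integral_distr nn_integral_cmult)
  finally have eq: "(\<integral>\<^sup>+y. indicator F y * f y \<partial>lborel)
      = ennreal ((1 / 2) ^ DIM('a)) * (\<integral>\<^sup>+u. indicator F (?s u) * f (?s u) \<partial>lborel)" .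
  have "?s u \<in> F" if "u \<in> F" for u
    using convexD[OF F(1,2) that, of "1 / 2" "1 / 2"] by simp
  then have "indicator F u * f (?s u) \<le> indicator F (?s u) * f (?s u)" for u
    by (simp split: split_indicator)
  then show ?thesis
    unfolding eq by (intro mult_left_mono nn_integral_mono) auto
qed

text \<open>The copies of \<open>F\<close> shrunk by one half towards \<open>a\<close> and towards \<open>b\<close> lie in \<open>F\<close>, and
  corresponding points of the two copies differ by \<open>(a - b) / 2\<close>, so they cannot both be close
  to \<open>m\<close>.\<close>

lemma convex_second_moment_lborel:
  fixes F :: "'a::euclidean_space set"
  assumes F: "convex F" "a \<in> F" "b \<in> F" and [measurable]: "F \<in> sets borel"
  shows "ennreal ((norm (a - b))\<^sup>2 / (16 * 2 ^ DIM('a))) * emeasure lborel F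
      \<le> (\<integral>\<^sup>+y. indicator F y * ennreal ((norm (y - m))\<^sup>2) \<partial>lborel)"
proof -
  define I where "I = (\<integral>\<^sup>+y. indicator F y * ennreal ((norm (y - m))\<^sup>2) \<partial>lborel)"
  define r where "r c u = ennreal ((norm ((1 / 2) *\<^sub>R c + (1 / 2) *\<^sub>R u - m))\<^sup>2)" for c u :: 'a
  have [measurable]: "r c \<in> borel_measurable borel" for c
    unfolding r_def by measurable
  let ?k = "ennreal ((1 / 2) ^ DIM('a))"
  have le: "?k * (\<integral>\<^sup>+u. indicator F u * r c u \<partial>lborel) \<le> I" if "c \<in> F" for c
    unfolding I_def r_def using F that
    by (intro nn_integral_lborel_half_shrink[where f = "\<lambda>y. ennreal ((norm (y - m))\<^sup>2)"]) auto
  have par: "(norm (p - q))\<^sup>2 + (norm (p + q))\<^sup>2 = 2 * (norm p)\<^sup>2 + 2 * (norm q)\<^sup>2" for p q :: 'a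
    by (simp add: power2_norm_eq_inner inner_diff_left inner_diff_right inner_add_left inner_add_right)
  have pt: "ennreal ((norm (a - b))\<^sup>2 / 8) \<le> r a u + r b u" for u
  proof -
    let ?p = "(1 / 2) *\<^sub>R a + (1 / 2) *\<^sub>R u - m" and ?q = "(1 / 2) *\<^sub>R b + (1 / 2) *\<^sub>R u - m"
    have "(norm (?p - ?q))\<^sup>2 + (norm (?p + ?q))\<^sup>2 = 2 * (norm ?p)\<^sup>2 + 2 * (norm ?q)\<^sup>2"
      by (rule par)
    moreover have "(norm (?p - ?q))\<^sup>2 = (norm (a - b))\<^sup>2 / 4"
    proof -
      have "?p - ?q = (1 / 2) *\<^sub>R (a - b)"
        by (simp add: algebra_simps)
      then show ?thesis
        by (simp only: norm_scaleR power_mult_distrib) (simp add: power2_eq_square)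
    qed
    ultimately have "(norm (a - b))\<^sup>2 / 8 \<le> (norm ?p)\<^sup>2 + (norm ?q)\<^sup>2"
      using zero_le_power2[of "norm (?p + ?q)"] by linarith
    then show ?thesis
      unfolding r_def ennreal_plus[OF zero_le_power2 zero_le_power2, symmetric] by (rule ennreal_leI)
  qed
  have "?k * (ennreal ((norm (a - b))\<^sup>2 / 8) * emeasure lborel F)
      = ?k * (\<integral>\<^sup>+u. indicator F u * ennreal ((norm (a - b))\<^sup>2 / 8) \<partial>lborel)"
    by (simp add: nn_integral_multc mult.commute)
  also have "\<dots> \<le> ?k * (\<integral>\<^sup>+u. indicator F u * r a u + indicator F u * r b u \<partial>lborel)"
    using pt by (intro mult_left_mono nn_integral_mono) (auto split: split_indicator)
  also have "\<dots> = ?k * (\<integral>\<^sup>+u. indicator F u * r a u \<partial>lborel) + ?k * (\<integral>\<^sup>+u. indicator F u * r b u \<partial>lborel)"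
    by (simp add: nn_integral_add distrib_left)
  also have "\<dots> \<le> I + I"
    by (intro add_mono le F)
  \<comment> \<open>The two copies may overlap, so each is bounded by the whole moment
    \<open>I\<close>; halving the sum turns the factor 1/8 from the parallelogram law into
    1/16.\<close>
  finally have "ennreal (1 / 2) * (?k * (ennreal ((norm (a - b))\<^sup>2 / 8) * emeasure lborel F))
      \<le> ennreal (1 / 2) * (I + I)"
    by (rule mult_left_mono) simp
  also have "\<dots> = (ennreal (1 / 2) + ennreal (1 / 2)) * I"
    by (simp only: distrib_left distrib_right)
  also have "ennreal (1 / 2) + ennreal (1 / 2) = 1"
    by (subst ennreal_plus[symmetric]) auto
  finally have "(ennreal (1 / 2) * ?k * ennreal ((norm (a - b))\<^sup>2 / 8)) * emeasure lborel F \<le> I"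
    by (simp add: mult.assoc)
  also have "ennreal (1 / 2) * ?k * ennreal ((norm (a - b))\<^sup>2 / 8)
      = ennreal ((norm (a - b))\<^sup>2 / (16 * 2 ^ DIM('a)))"
    by (subst ennreal_mult[symmetric], simp, simp)+ (simp add: power_divide)
  finally show ?thesis
    unfolding I_def .
qed

text \<open>The bound \<open>g \<le> c2\<close> controls the mass by the volume and
  \<open>g \<ge> c1\<close> controls the moment from below by the Lebesgue moment; together they
  cost the factor \<open>c1 / c2\<close>.\<close>

lemma convex_second_moment_density:
  fixes F :: "'a::euclidean_space set" and g :: "'a \<Rightarrow> real"
  assumes F: "convex F" "a \<in> F" "b \<in> F" and [measurable]: "F \<in> sets borel" "g \<in> borel_measurable borel"
    and c: "0 < c1" and g: "\<And>y. y \<in> F \<Longrightarrow> g y \<in> {c1..c2}"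
  shows "ennreal (c1 / c2 * ((norm (a - b))\<^sup>2 / (16 * 2 ^ DIM('a)))) * emeasure (density lborel g) F
      \<le> (\<integral>\<^sup>+y. indicator F y * ennreal ((norm (y - m))\<^sup>2) \<partial>density lborel g)"
proof -
  define K where "K = (norm (a - b))\<^sup>2 / (16 * 2 ^ DIM('a))"
  have K: "0 \<le> K"
    by (simp add: K_def)
  have c2: "0 < c2"
    using g[OF F(2)] c by simp
  have "emeasure (density lborel g) F = (\<integral>\<^sup>+y. ennreal (g y) * indicator F y \<partial>lborel)"
    by (simp add: emeasure_density)
  also have "\<dots> \<le> (\<integral>\<^sup>+y. ennreal c2 * indicator F y \<partial>lborel)"
    using g by (intro nn_integral_mono) (auto intro!: ennreal_leI split: split_indicator)
  also have "\<dots> = ennreal c2 * emeasure lborel F"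
    by (simp add: nn_integral_cmult)
  finally have "ennreal (c1 / c2 * K) * emeasure (density lborel g) F
      \<le> ennreal (c1 / c2 * K) * (ennreal c2 * emeasure lborel F)"
    by (rule mult_left_mono) simp
  also have "\<dots> = ennreal c1 * (ennreal K * emeasure lborel F)"
    using c c2 K by (simp add: mult.assoc[symmetric] ennreal_mult'[symmetric])
  also have "\<dots> \<le> ennreal c1 * (\<integral>\<^sup>+y. indicator F y * ennreal ((norm (y - m))\<^sup>2) \<partial>lborel)"
    unfolding K_def by (intro mult_left_mono convex_second_moment_lborel F) auto
  also have "\<dots> = (\<integral>\<^sup>+y. ennreal c1 * (indicator F y * ennreal ((norm (y - m))\<^sup>2)) \<partial>lborel)"
    by (simp add: nn_integral_cmult)
  also have "\<dots> \<le> (\<integral>\<^sup>+y. ennreal (g y) * (indicator F y * ennreal ((norm (y - m))\<^sup>2)) \<partial>lborel)"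
    using g by (intro nn_integral_mono) (auto intro!: mult_right_mono ennreal_leI split: split_indicator)
  also have "\<dots> = (\<integral>\<^sup>+y. indicator F y * ennreal ((norm (y - m))\<^sup>2) \<partial>density lborel g)"
    by (simp add: nn_integral_density)
  finally show ?thesis
    unfolding K_def .
qed

text \<open>The factor of \<open>convex_second_moment_density\<close>; the type argument carries the
  dimension.\<close>

definition cell_constant :: "'a::euclidean_space itself \<Rightarrow> real \<Rightarrow> real \<Rightarrow> real" where
  "cell_constant _ c1 c2 = c1 / (c2 * (16 * 2 ^ DIM('a)))"

lemma P2_square_integrable:
  assumes "\<nu> \<in> P2"
  shows "square_integrable \<nu> (\<lambda>y. y)"
  using P2_D[OF assms] measurable_cong_sets[of \<nu> borel] by (simp add: square_integrable_def)

text \<open>The parallel axis identity: the squared distance is expanded about \<open>m\<close>, and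
  the cross term integrates to zero by the choice of \<open>m\<close>.\<close>

lemma second_moment_about_barycenter:
  fixes \<nu> :: "'a::euclidean_space measure"
  assumes \<nu>: "\<nu> \<in> P2" and [measurable]: "F \<in> sets borel"
    and m: "measure \<nu> F *\<^sub>R m = (\<integral>y. indicator F y *\<^sub>R y \<partial>\<nu>)"
  shows "integrable \<nu> (\<lambda>y. indicator F y * (norm (p - y))\<^sup>2)"
    "(\<integral>y. indicator F y * (norm (p - y))\<^sup>2 \<partial>\<nu>)
      = measure \<nu> F * (norm (p - m))\<^sup>2 + (\<integral>y. indicator F y * (norm (y - m))\<^sup>2 \<partial>\<nu>)"
proof -
  interpret prob_space \<nu> using \<nu> by (rule P2_D)
  note [measurable_cong] = P2_D(2)[OF \<nu>]
  have int: "integrable \<nu> (\<lambda>y. indicator F y * (norm (q - y))\<^sup>2)" for q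
  proof (rule Bochner_Integration.integrable_bound)
    show "integrable \<nu> (\<lambda>y. (norm (q - y))\<^sup>2)"
      using square_integrable_diff[OF square_integrable_const P2_square_integrable[OF \<nu>]]
      by (simp add: square_integrable_def)
  qed (auto split: split_indicator)
  then show "integrable \<nu> (\<lambda>y. indicator F y * (norm (p - y))\<^sup>2)" .
  have sq: "square_integrable \<nu> (\<lambda>y. indicator F y *\<^sub>R y)"
    by (rule square_integrable_bound[OF P2_square_integrable[OF \<nu>]]) (auto split: split_indicator)
  have int_inner: "integrable \<nu> (\<lambda>y. (indicator F y *\<^sub>R y) \<bullet> (p - m))"
    by (rule integrable_inner[OF sq square_integrable_const])
  have int1: "integrable \<nu> (\<lambda>y. indicator F y *\<^sub>R y)"
  proof (rule Bochner_Integration.integrable_bound)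
    show "integrable \<nu> (\<lambda>y. 1 + (norm y)\<^sup>2)"
      using P2_D(4)[OF \<nu>] by simp
    have "norm y \<le> 1 + (norm y)\<^sup>2" for y :: 'a
      using sum_squares_bound[of "norm y" 1] norm_ge_zero[of y] zero_le_power2[of "norm y"]
      unfolding power_one mult_1_right by linarith
    then show "AE y in \<nu>. norm (indicator F y *\<^sub>R y) \<le> norm (1 + (norm y)\<^sup>2)"
      by (auto split: split_indicator)
  qed measurable
  have m': "(\<integral>y. (indicator F y *\<^sub>R y) \<bullet> (p - m) \<partial>\<nu>) = measure \<nu> F * (m \<bullet> (p - m))"
    using m by (subst integral_inner_left) (use int1 in \<open>auto simp flip: inner_scaleR_left\<close>)
  have intF: "integrable \<nu> (\<lambda>y. indicator F y * c :: real)" for c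
    using P2_D(2)[OF \<nu>]
    by (intro integrable_mult_left integrable_real_indicator) (simp_all add: emeasure_eq_measure)
  have eq: "indicator F y * (norm (p - y))\<^sup>2 = (indicator F y * ((norm (p - m))\<^sup>2 + 2 * (m \<bullet> (p - m)))
      - 2 * ((indicator F y *\<^sub>R y) \<bullet> (p - m))) + indicator F y * (norm (m - y))\<^sup>2" for y
    by (simp add: power2_norm_eq_inner inner_diff_left inner_diff_right inner_commute
        split: split_indicator)
  have split: "(\<integral>y. (u1 y - 2 * u2 y) + u3 y \<partial>\<nu>) = (\<integral>y. u1 y \<partial>\<nu>) - 2 * (\<integral>y. u2 y \<partial>\<nu>) + (\<integral>y. u3 y \<partial>\<nu>)"
    if "integrable \<nu> u1" "integrable \<nu> u2" "integrable \<nu> u3" for u1 u2 u3 :: "'a \<Rightarrow> real"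
    using that by simp
  have const: "(\<integral>y. indicator F y * c \<partial>\<nu>) = measure \<nu> F * c" for c :: real
    using P2_D(3)[OF \<nu>] by simp
  have "(\<integral>y. indicator F y * (norm (p - y))\<^sup>2 \<partial>\<nu>)
      = measure \<nu> F * (norm (p - m))\<^sup>2 + (\<integral>y. indicator F y * (norm (m - y))\<^sup>2 \<partial>\<nu>)"
    unfolding eq split[OF intF int_inner int] const m' by (simp add: distrib_left)
  then show "(\<integral>y. indicator F y * (norm (p - y))\<^sup>2 \<partial>\<nu>)
      = measure \<nu> F * (norm (p - m))\<^sup>2 + (\<integral>y. indicator F y * (norm (y - m))\<^sup>2 \<partial>\<nu>)"
    by (simp add: norm_minus_commute)
qed

text \<open>After the parallel axis identity, the remaining variance of the cell controls the
  distance of any two of its points by \<open>convex_second_moment_density\<close>, and so the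
  diameter.\<close>

lemma cell_moment_lower_bound:
  fixes \<nu> :: "'a::euclidean_space measure"
  assumes \<nu>: "\<nu> \<in> P2" and g: "is_density \<nu> g"
    and F: "F \<in> sets borel" "convex F" "bounded F" "0 < measure \<nu> F"
    and c: "0 < c1" "\<And>y. y \<in> F \<Longrightarrow> g y \<in> {c1..c2}"
    and m: "m = (1 / measure \<nu> F) *\<^sub>R (LINT y:F|lborel. g y *\<^sub>R y)"
  shows "measure \<nu> F * ((norm (p - m))\<^sup>2 + cell_constant TYPE('a) c1 c2 * (diameter F)\<^sup>2)
      \<le> (\<integral>y. indicator F y * (norm (p - y))\<^sup>2 \<partial>\<nu>)"
proof -
  interpret prob_space \<nu> using \<nu> by (rule P2_D)
  note [measurable_cong] = P2_D(2)[OF \<nu>]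
  note [measurable] = F(1)
  have [measurable]: "g \<in> borel_measurable borel" and g0: "\<And>y. 0 \<le> g y"
    and \<nu>_eq: "\<nu> = density lborel (\<lambda>y. ennreal (g y))"
    using g by (auto simp: is_density_def)
  have "(\<integral>y. indicator F y *\<^sub>R y \<partial>\<nu>) = (\<integral>y. g y *\<^sub>R (indicator F y *\<^sub>R y) \<partial>lborel)"
    unfolding \<nu>_eq using g0 by (subst integral_density) auto
  then have bary: "measure \<nu> F *\<^sub>R m = (\<integral>y. indicator F y *\<^sub>R y \<partial>\<nu>)"
    using F(4) unfolding m set_lebesgue_integral_def by (simp add: mult.commute)
  note moment = second_moment_about_barycenter[OF \<nu> F(1) bary]
  define V where "V = (\<integral>y. indicator F y * (norm (y - m))\<^sup>2 \<partial>\<nu>)"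
  define K where "K = cell_constant TYPE('a) c1 c2"
  obtain y0 where "y0 \<in> F"
    using F(4) by fastforce
  then have "0 < c2"
    using c(1) c(2)[of y0] by simp
  then have K: "0 < K"
    using c(1) by (simp add: K_def cell_constant_def)
  have V: "0 \<le> V"
    unfolding V_def by (intro integral_nonneg_AE) auto
  have ab: "K * (norm (a - b))\<^sup>2 * measure \<nu> F \<le> V" if "a \<in> F" "b \<in> F" for a b
  proof -
    have "ennreal (K * (norm (a - b))\<^sup>2 * measure \<nu> F) = ennreal (K * (norm (a - b))\<^sup>2) * emeasure \<nu> F"
      using K by (simp add: emeasure_eq_measure ennreal_mult')
    also have "\<dots> = ennreal (c1 / c2 * ((norm (a - b))\<^sup>2 / (16 * 2 ^ DIM('a)))) * emeasure \<nu> F"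
      by (simp add: K_def cell_constant_def)
    also have "\<dots> \<le> (\<integral>\<^sup>+y. indicator F y * ennreal ((norm (y - m))\<^sup>2) \<partial>\<nu>)"
      unfolding \<nu>_eq using F c that by (intro convex_second_moment_density) auto
    also have "\<dots> = (\<integral>\<^sup>+y. ennreal (indicator F y * (norm (m - y))\<^sup>2) \<partial>\<nu>)"
      by (intro nn_integral_cong) (simp add: norm_minus_commute split: split_indicator)
    also have "\<dots> = ennreal V"
      unfolding V_def using moment(1)[of m]
      by (subst nn_integral_eq_integral) (auto simp: norm_minus_commute)
    finally show ?thesis
      using V by (simp add: ennreal_le_iff)
  qed
  have "diameter F \<le> sqrt (V / (K * measure \<nu> F))"
  proof (rule diameter_le)
    fix a b assume "a \<in> F" "b \<in> F"
    from ab[OF this] have "(norm (a - b))\<^sup>2 \<le> V / (K * measure \<nu> F)"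
      using K F(4) by (simp add: field_simps)
    then show "norm (a - b) \<le> sqrt (V / (K * measure \<nu> F))"
      by (rule real_le_rsqrt)
  qed (use \<open>y0 \<in> F\<close> in auto)
  then have "(diameter F)\<^sup>2 \<le> V / (K * measure \<nu> F)"
    using K F(4) V diameter_ge_0[OF F(3)] by (simp add: real_le_rsqrt sqrt_ge_absD)
  then have "measure \<nu> F * (K * (diameter F)\<^sup>2) \<le> V"
    using K F(4) by (simp add: field_simps)
  then show ?thesis
    using moment(2)[of p] unfolding V_def K_def by (simp add: distrib_left)
qed

section \<open>The error estimate\<close>

lemma discrete_subdifferential_eq_INT:
  "discrete_subdifferential A \<phi>h p = (\<Inter>q\<in>A. {y. (q - p) \<bullet> y \<le> \<phi>h q - \<phi>h p})"
  by (auto simp: discrete_subdifferential_def le_diff_eq add.commute)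

lemma closed_discrete_subdifferential: "closed (discrete_subdifferential A \<phi>h p)"
  by (simp add: discrete_subdifferential_eq_INT closed_INT closed_halfspace_le)

lemma convex_discrete_subdifferential: "convex (discrete_subdifferential A \<phi>h p)"
  by (simp add: discrete_subdifferential_eq_INT convex_INT convex_halfspace_le)

text \<open>Any node maximising \<open>q \<bullet> y - \<phi>h q\<close> has \<open>y\<close> in its
  subdifferential.\<close>

lemma discrete_subdifferential_cover:
  assumes "finite A" "A \<noteq> {}"
  shows "\<exists>p\<in>A. y \<in> discrete_subdifferential A \<phi>h p"
proof -
  have "Max ((\<lambda>q. q \<bullet> y - \<phi>h q) ` A) \<in> (\<lambda>q. q \<bullet> y - \<phi>h q) ` A"
    using assms by (intro Max_in) auto
  then obtain p where p: "p \<in> A" "Max ((\<lambda>q. q \<bullet> y - \<phi>h q) ` A) = p \<bullet> y - \<phi>h p"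
    by blast
  have "q \<bullet> y - \<phi>h q \<le> p \<bullet> y - \<phi>h p" if "q \<in> A" for q
    using that assms by (intro Max_ge[of "(\<lambda>q. q \<bullet> y - \<phi>h q) ` A", unfolded p(2)]) auto
  then have "y \<in> discrete_subdifferential A \<phi>h p"
    by (fastforce simp: discrete_subdifferential_def inner_diff_left)
  with p(1) show ?thesis by blast
qed

lemma discrete_measure_node:
  assumes "inj_on x {1..N}" "i \<in> {1..N}"
  shows "emeasure (discrete_measure N x w) {x i} = ennreal (w i)"
proof -
  have "(\<Sum>j=1..N. ennreal (w j) * indicator {x i} (x j)) = (\<Sum>j=1..N. if j = i then ennreal (w i) else 0)"
  proof (rule sum.cong[OF refl])
    fix j assume "j \<in> {1..N}"
    then have "x j = x i \<longleftrightarrow> j = i"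
      using assms by (simp only: inj_on_eq_iff)
    then show "ennreal (w j) * indicator {x i} (x j) = (if j = i then ennreal (w i) else 0)"
      by simp
  qed
  also have "\<dots> = ennreal (w i)"
    using assms(2) by (simp only: sum.delta finite_atLeastAtMost if_True)
  finally show ?thesis
    by (simp only: emeasure_discrete_measure borel_singleton sets.empty_sets)
qed

lemma AE_discrete_measure: "AE z in discrete_measure N x w. z \<in> x ` {1..N}"
proof (rule AE_I)
  have sets: "- (x ` {1..N}) \<in> sets borel"
    by (intro borel_open open_Compl finite_imp_closed finite_imageI finite_atLeastAtMost)
  then show "- (x ` {1..N}) \<in> sets (discrete_measure N x w)"
    unfolding discrete_measure_def sets_distr .
  show "{z \<in> space (discrete_measure N x w). z \<notin> x ` {1..N}} \<subseteq> - (x ` {1..N})"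
    by blast
  show "emeasure (discrete_measure N x w) (- (x ` {1..N})) = 0"
    unfolding emeasure_discrete_measure[OF sets] by (intro sum.neutral) simp
qed

section \<open>The transport setting and the variance of the target\<close>

context
  fixes lam c1 c2 :: real and \<mu> \<nu> :: "'a::euclidean_space measure" and f g \<phi> :: "'a \<Rightarrow> real"
  assumes setting: "transport_setting c1 c2 lam \<mu> \<nu> f g \<phi>"
begin

lemma setting_P2: "\<mu> \<in> P2" "\<nu> \<in> P2"
  and setting_density: "is_density \<nu> g"
  and setting_gradient: "distr \<mu> borel (gradient \<phi>) = \<nu>"
  and setting_target: "bounded {y. 0 < g y}" "convex {y. 0 < g y}" "\<And>y. 0 < g y \<Longrightarrow> g y \<in> {c1..c2}"
  using setting unfolding transport_setting_def lambda_regular_def optimal_transport_map_def by blast+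

interpretation smooth_convex \<phi> "gradient \<phi>" lam
  using setting by (intro smooth_convex_gradient) (auto simp: transport_setting_def lambda_regular_def)

lemma setting_lam_pos: "0 < lam"
  by (rule lam_pos)

lemma setting_borel_measurable: "g \<in> borel_measurable borel"
  using setting_density by (simp add: is_density_def)

lemma setting_AE_target: "AE y in \<nu>. 0 < g y"
proof -
  have eq: "\<nu> = density lborel (\<lambda>y. ennreal (g y))"
    using setting_density by (simp add: is_density_def)
  show ?thesis
    unfolding eq using setting_borel_measurable by (subst AE_density) auto
qed

lemma sets_target: "{y. 0 < g y} \<in> sets borel"
  using borel_measurable_less[of "\<lambda>_. 0" borel g] setting_borel_measurable by simp

text \<open>The gradient pushes \<mu> to \<nu> and is Lipschitz with constant \<open>lam\<close>, so
  it scales the spread about the origin by at most this factor.\<close>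

lemma variance_le: "(\<integral>y. (norm (gradient \<phi> 0 - y))\<^sup>2 \<partial>\<nu>) \<le> lam\<^sup>2 * (\<integral>x. (norm x)\<^sup>2 \<partial>\<mu>)"
proof -
  interpret prob_space \<mu> by (rule P2_D(1)[OF setting_P2(1)])
  note [measurable_cong] = P2_D(2)[OF setting_P2(1)]
  note sq = P2_square_integrable[OF setting_P2(1)]
  have "(\<integral>y. (norm (gradient \<phi> 0 - y))\<^sup>2 \<partial>\<nu>) = (\<integral>x. (norm (gradient \<phi> 0 - gradient \<phi> x))\<^sup>2 \<partial>\<mu>)"
    unfolding setting_gradient[symmetric] by (subst integral_distr) auto
  also have "\<dots> \<le> (\<integral>x. lam\<^sup>2 * (norm x)\<^sup>2 \<partial>\<mu>)"
  proof (rule integral_mono)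
    show "integrable \<mu> (\<lambda>x. (norm (gradient \<phi> 0 - gradient \<phi> x))\<^sup>2)"
      using square_integrable_diff[OF square_integrable_const
          square_integrable_gradient[OF finite_measure_axioms sq]]
      by (simp add: square_integrable_def)
    show "(norm (gradient \<phi> 0 - gradient \<phi> x))\<^sup>2 \<le> lam\<^sup>2 * (norm x)\<^sup>2" for x
      using power_mono[OF gradient_lipschitz[of 0 x], of 2] by (simp add: power_mult_distrib)
  qed (use sq in \<open>simp add: square_integrable_def\<close>)
  finally show ?thesis by simp
qed

text \<open>The whole target is treated as a single convex cell of mass one. Its diameter is
  positive because a measure with a density gives no mass to a point.\<close>

lemma variance_lower_bound:
  assumes c1: "0 < c1"
  obtains k where "0 < k" "\<And>p. k \<le> (\<integral>y. (norm (p - y))\<^sup>2 \<partial>\<nu>)"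
proof -
  interpret prob_space \<nu> by (rule P2_D(1)[OF setting_P2(2)])
  define Y where "Y = {y. 0 < g y}"
  have Y: "Y \<in> sets borel" "measure \<nu> Y = 1" "bounded Y" "convex Y"
    using sets_target setting_target setting_AE_target P2_D(2)[OF setting_P2(2)]
    by (auto simp: Y_def prob_eq_1)
  obtain y0 where y0: "y0 \<in> Y"
    using Y(2) by fastforce
  then have c2: "0 < c2"
    using c1 setting_target(3)[of y0] by (simp add: Y_def)
  define k where "k = cell_constant TYPE('a) c1 c2 * (diameter Y)\<^sup>2"
  have "diameter Y \<noteq> 0"
  proof
    assume "diameter Y = 0"
    then have "Y \<subseteq> {y0}"
      using diameter_bounded_bound[OF Y(3)] y0 by (metis dist_le_zero_iff singletonI subsetI)
    then have "Y = {y0}"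
      using y0 by blast
    moreover have "emeasure \<nu> {y0} = 0"
    proof -
      have "\<nu> = density lborel (\<lambda>y. ennreal (g y))"
        using setting_density by (simp add: is_density_def)
      moreover have "AE y in lborel. y \<noteq> y0"
        by (rule AE_lborel_singleton)
      ultimately show ?thesis
        using setting_borel_measurable
        by (auto simp: emeasure_density nn_integral_0_iff_AE elim!: eventually_mono)
    qed
    ultimately show False
      using Y(2) by (simp add: measure_def)
  qed
  then have "0 < k"
    using c1 c2 by (simp add: k_def cell_constant_def)
  moreover have "k \<le> (\<integral>y. (norm (p - y))\<^sup>2 \<partial>\<nu>)" for p
  proof -
    define m where "m = (1 / measure \<nu> Y) *\<^sub>R (LINT y:Y|lborel. g y *\<^sub>R y)"
    have "k \<le> (norm (p - m))\<^sup>2 + k"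
      by simp
    also have "\<dots> \<le> (\<integral>y. indicator Y y * (norm (p - y))\<^sup>2 \<partial>\<nu>)"
      using cell_moment_lower_bound[OF setting_P2(2) setting_density Y(1,4,3) _ c1 _ m_def, of c2 p]
        Y(2) setting_target(3) by (simp add: k_def Y_def)
    also have "\<dots> = (\<integral>y. (norm (p - y))\<^sup>2 \<partial>\<nu>)"
    proof (rule integral_cong_AE)
      show "AE y in \<nu>. indicator Y y * (norm (p - y))\<^sup>2 = (norm (p - y))\<^sup>2"
        using setting_AE_target by eventually_elim (simp add: Y_def)
    qed (use Y(1) in \<open>simp_all add: measurable_cong_sets[OF P2_D(2)[OF setting_P2(2)] refl]\<close>)
    finally show ?thesis .
  qed
  ultimately show thesis
    by (rule that)
qed

section \<open>Laguerre cells of a semidiscrete solution and the error estimate\<close>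

context
  fixes N :: nat and x :: "nat \<Rightarrow> 'a" and w :: "nat \<Rightarrow> real" and \<phi>h :: "'a \<Rightarrow> real"
  assumes solution: "semidiscrete_solution \<nu> g N x w \<phi>h"
begin

lemma solution_D: "prob_space (discrete_measure N x w)" "inj_on x {1..N}"
  "i \<in> {1..N} \<Longrightarrow> 0 < w i" "i \<in> {1..N} \<Longrightarrow> measure \<nu> (laguerre_cell g N x \<phi>h i) = w i"
  using solution by (auto simp: semidiscrete_solution_def)

lemma cell_properties:
  "laguerre_cell g N x \<phi>h i \<in> sets borel" "convex (laguerre_cell g N x \<phi>h i)"
  "bounded (laguerre_cell g N x \<phi>h i)"
  "y \<in> laguerre_cell g N x \<phi>h i \<Longrightarrow> g y \<in> {c1..c2}"
  using sets_target setting_target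
  by (auto simp: laguerre_cell_def borel_closed closed_discrete_subdifferential
      intro: convex_Int convex_discrete_subdifferential bounded_subset)

lemma cells_cover: "AE y in \<nu>. \<exists>i\<in>{1..N}. y \<in> laguerre_cell g N x \<phi>h i"
proof -
  have "N \<noteq> 0"
  proof
    assume "N = 0"
    then have "emeasure (discrete_measure N x w) UNIV = 0"
      by (simp add: emeasure_discrete_measure)
    then show False
      using prob_space.emeasure_space_1[OF solution_D(1)] by (simp add: discrete_measure_def)
  qed
  then have "\<exists>p\<in>x ` {1..N}. y \<in> discrete_subdifferential (x ` {1..N}) \<phi>h p" for y
    by (intro discrete_subdifferential_cover) auto
  then show ?thesis
    using setting_AE_target by (auto simp: laguerre_cell_def elim!: eventually_mono)
qed

text \<open>The slack \<open>e\<close> makes up for not knowing that the infimum in \<^const>\<open>W2\<close> is attained.\<close>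

lemma error_sum_le:
  assumes e: "0 < e"
  defines "a \<equiv> W2 \<mu> (discrete_measure N x w) + e"
  shows "(\<Sum>i=1..N. \<integral>y. indicator (laguerre_cell g N x \<phi>h i) y * (norm (gradient \<phi> (x i) - y))\<^sup>2 \<partial>\<nu>)
      \<le> (2 * sqrt lam * sqrt a * sqrt (W2 \<mu> \<nu> + a) + lam * a)\<^sup>2"
proof -
  let ?T = "gradient \<phi>"
  note One_nat_def [simp del]
  note P2_h = discrete_measure_P2[OF solution_D(1)]
  obtain \<pi> where \<pi>: "\<pi> \<in> couplings \<mu> (discrete_measure N x w)" and cost: "L2_norm \<pi> (\<lambda>p. fst p - snd p) \<le> a"
    using W2_near_optimal_coupling[OF setting_P2(1) P2_h e] unfolding a_def by blast
  note D = couplings_D[OF \<pi>]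
  have a: "0 < a"
    using e W2_nonneg[of \<mu> "discrete_measure N x w"] by (simp add: a_def)
  interpret \<nu>: prob_space \<nu> by (rule P2_D(1)[OF setting_P2(2)])
  interpret semidiscrete_gluing \<pi> \<nu> "{1..N}" x w "laguerre_cell g N x \<phi>h"
  proof (rule semidiscrete_gluing.intro)
    show "sets \<pi> = sets (borel \<Otimes>\<^sub>M borel)"
      using D(1) unfolding borel_prod .
    show "prob_space \<pi>"
      using couplings_prob_space[OF \<pi>] P2_D(1)[OF setting_P2(1)] by simp
    show "sets \<nu> = sets borel"
      by (rule P2_D(2)[OF setting_P2(2)])
    show "emeasure (distr \<pi> borel snd) {x i} = ennreal (w i)" if "i \<in> {1..N}" for i
      unfolding D(3) by (rule discrete_measure_node[OF solution_D(2) that])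
    show "AE z in distr \<pi> borel snd. z \<in> x ` {1..N}"
      unfolding D(3) by (rule AE_discrete_measure)
    show "emeasure \<nu> (laguerre_cell g N x \<phi>h i) = ennreal (w i)" if "i \<in> {1..N}" for i
      using solution_D(4)[OF that] by (simp add: \<nu>.emeasure_eq_measure)
  qed (use solution_D cell_properties cells_cover \<nu>.prob_space_axioms in auto)
  interpret glued: prob_space glued by (rule prob_space_glued)
  define X where "X q = fst (fst q)" for q :: "('a \<times> 'a) \<times> 'a"
  define Z where "Z q = snd (fst q)" for q :: "('a \<times> 'a) \<times> 'a"
  define Y where "Y q = snd q" for q :: "('a \<times> 'a) \<times> 'a"
  have meas [measurable]: "X \<in> borel_measurable glued" "Z \<in> borel_measurable glued" "Y \<in> borel_measurable glued"
    using measurable_coordinates by (simp_all add: X_def[abs_def] Z_def[abs_def] Y_def[abs_def])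
  have law_X: "distr glued borel X = \<mu>"
    using distr_distr[OF D(4) measurable_coordinates(4)]
    by (simp add: distr_glued_fst D(2) comp_def X_def[abs_def])
  have law_Z: "distr glued borel Z = discrete_measure N x w"
    using distr_distr[OF D(5) measurable_coordinates(4)]
    by (simp add: distr_glued_fst D(3) comp_def Z_def[abs_def])
  have law_Y: "distr glued borel Y = \<nu>"
    using distr_glued_snd by (simp add: Y_def[abs_def])
  have law_TX: "distr glued borel (\<lambda>q. ?T (X q)) = distr glued borel Y"
    using distr_comp_eq[OF law_X setting_gradient meas(1) borel_measurable_T] law_Y by simp
  have sq_X: "square_integrable glued X" and sq_Z: "square_integrable glued Z"
    and sq_Y: "square_integrable glued Y"
    by (simp_all add: square_integrable_distr law_X law_Y law_Z setting_P2 P2_h)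
  note sq_T = square_integrable_gradient[OF glued.finite_measure_axioms]
  note sq_TX = sq_T[OF sq_X] and sq_TZ = sq_T[OF sq_Z]
  have XZ: "L2_norm glued (\<lambda>q. X q - Z q) \<le> a"
  proof -
    have "L2_norm glued (\<lambda>q. X q - Z q) = L2_norm (distr glued \<pi> fst) (\<lambda>p. fst p - snd p)"
      unfolding L2_norm_def X_def Z_def using D(4,5) measurable_coordinates(4)
      by (subst integral_distr) auto
    then show ?thesis
      using cost by (simp add: distr_glued_fst)
  qed
  define b where "b = L2_norm glued (\<lambda>q. X q - ?T (X q))"
  have b: "b \<le> W2 \<mu> \<nu>" "0 \<le> b"
  proof -
    have "b = L2_norm (distr glued borel X) (\<lambda>x. x - ?T x)"
      unfolding L2_norm_def b_def by (subst integral_distr) auto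
    then show "b \<le> W2 \<mu> \<nu>"
      using gradient_cost_le_W2[OF setting_P2 setting_gradient] by (simp add: law_X)
  qed (simp add: b_def)
  have ZY: "L2_norm glued (\<lambda>q. Z q - Y q) \<le> a + b"
  proof -
    have "AE q in glued. Z q \<in> x ` {1..N} \<and> Y q \<in> discrete_subdifferential (x ` {1..N}) \<phi>h (Z q)"
      using AE_glued by eventually_elim (auto simp: Z_def Y_def laguerre_cell_def)
    \<comment> \<open>Without nodes, \<open>AE_glued\<close> would assert a falsehood almost
      everywhere, which a probability measure excludes.\<close>
    moreover have "x ` {1..N} \<noteq> {}"
      using AE_glued glued.AE_False by (cases "N = 0") auto
    \<comment> \<open>The image of \<open>X\<close> under the gradient has the law of
      \<open>Y\<close> and serves as the competitor.\<close>
    ultimately have "L2_norm glued (\<lambda>q. Z q - Y q) \<le> L2_norm glued (\<lambda>q. Z q - ?T (X q))"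
      by (intro discrete_subdifferential_optimal[OF glued.finite_measure_axioms _ _ sq_Z sq_Y sq_TX law_TX])
         auto
    also have "\<dots> = L2_norm glued (\<lambda>q. (Z q - X q) + (X q - ?T (X q)))"
      by simp
    also have "\<dots> \<le> L2_norm glued (\<lambda>q. Z q - X q) + b"
      unfolding b_def by (intro L2_norm_triangle square_integrable_diff sq_X sq_Z sq_TX)
    finally show ?thesis
      using XZ L2_norm_minus_commute[of glued Z X] by simp
  qed
  have XY: "L2_norm glued (\<lambda>q. X q - Y q) \<le> 2 * a + b"
  proof -
    have "L2_norm glued (\<lambda>q. X q - Y q) = L2_norm glued (\<lambda>q. (X q - Z q) + (Z q - Y q))"
      by simp
    also have "\<dots> \<le> L2_norm glued (\<lambda>q. X q - Z q) + L2_norm glued (\<lambda>q. Z q - Y q)"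
      by (intro L2_norm_triangle square_integrable_diff sq_X sq_Z sq_Y)
    finally show ?thesis
      using XZ ZY by simp
  qed
  have TXY: "L2_norm glued (\<lambda>q. ?T (X q) - Y q) \<le> 2 * sqrt lam * sqrt a * sqrt (W2 \<mu> \<nu> + a)"
  proof (rule power2_le_imp_le)
    have "(L2_norm glued (\<lambda>q. ?T (X q) - Y q))\<^sup>2 \<le> lam * ((L2_norm glued (\<lambda>q. X q - Y q))\<^sup>2 - b\<^sup>2)"
      unfolding b_def by (rule gradient_stability[OF glued.finite_measure_axioms sq_X sq_Y law_TX])
    also have "\<dots> \<le> lam * ((2 * a + b)\<^sup>2 - b\<^sup>2)"
      using lam_pos XY by (intro mult_left_mono diff_right_mono power_mono) auto
    \<comment> \<open>The squares of \<open>b\<close> cancel, and the 4 is the source of the factor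
      2 in \<open>error_bound\<close>. Only now can \<open>b\<close> be replaced by
      \<open>W2 \<mu> \<nu>\<close>, since before it also occurred with a negative sign.\<close>
    also have "\<dots> = 4 * (lam * a) * (b + a)"
      by (simp add: power2_eq_square algebra_simps)
    also have "\<dots> \<le> 4 * (lam * a) * (W2 \<mu> \<nu> + a)"
      using b a lam_pos by (intro mult_left_mono) auto
    also have "\<dots> = (2 * sqrt lam * sqrt a * sqrt (W2 \<mu> \<nu> + a))\<^sup>2"
      using a lam_pos W2_nonneg[of \<mu> \<nu>] by (simp add: power_mult_distrib)
    finally show "(L2_norm glued (\<lambda>q. ?T (X q) - Y q))\<^sup>2 \<le> (2 * sqrt lam * sqrt a * sqrt (W2 \<mu> \<nu> + a))\<^sup>2" .
  qed (use a lam_pos W2_nonneg[of \<mu> \<nu>] in simp)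
  \<comment> \<open>The estimate is wanted at the nodes \<open>Z\<close> instead of
    \<open>X\<close>; the Lipschitz bound pays for the move with the last term of
    \<open>error_bound\<close>.\<close>
  have TZX: "L2_norm glued (\<lambda>q. ?T (Z q) - ?T (X q)) \<le> lam * a"
  proof -
    have "L2_norm glued (\<lambda>q. ?T (Z q) - ?T (X q)) \<le> L2_norm glued (\<lambda>q. lam *\<^sub>R (X q - Z q))"
    proof (rule L2_norm_mono)
      show "square_integrable glued (\<lambda>q. lam *\<^sub>R (X q - Z q))"
        using square_integrable_diff[OF sq_X sq_Z]
        by (auto simp: square_integrable_def power_mult_distrib)
      show "norm (?T (Z q) - ?T (X q)) \<le> norm (lam *\<^sub>R (X q - Z q))" for q
        using gradient_lipschitz[of "Z q" "X q"] lam_pos by (simp add: norm_minus_commute)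
    qed (intro square_integrable_diff sq_TZ sq_TX)
    also have "\<dots> = lam * L2_norm glued (\<lambda>q. X q - Z q)"
      using lam_pos by (simp add: L2_norm_def power_mult_distrib real_sqrt_mult)
    also have "\<dots> \<le> lam * a"
      using XZ lam_pos by simp
    finally show ?thesis .
  qed
  have TZY: "L2_norm glued (\<lambda>q. ?T (Z q) - Y q) \<le> 2 * sqrt lam * sqrt a * sqrt (W2 \<mu> \<nu> + a) + lam * a"
  proof -
    have "L2_norm glued (\<lambda>q. ?T (Z q) - Y q) = L2_norm glued (\<lambda>q. (?T (Z q) - ?T (X q)) + (?T (X q) - Y q))"
      by simp
    also have "\<dots> \<le> L2_norm glued (\<lambda>q. ?T (Z q) - ?T (X q)) + L2_norm glued (\<lambda>q. ?T (X q) - Y q)"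
      by (intro L2_norm_triangle square_integrable_diff sq_TZ sq_TX sq_Y)
    finally show ?thesis
      using TZX TXY by simp
  qed
  have cell_int: "(\<integral>\<^sup>+y. indicator (laguerre_cell g N x \<phi>h i) y * ennreal ((norm (?T (x i) - y))\<^sup>2) \<partial>\<nu>)
      = ennreal (\<integral>y. indicator (laguerre_cell g N x \<phi>h i) y * (norm (?T (x i) - y))\<^sup>2 \<partial>\<nu>)" for i
  proof -
    have "square_integrable \<nu> (\<lambda>y. ?T (x i) - y)"
      by (intro square_integrable_diff \<nu>.square_integrable_const P2_square_integrable setting_P2)
    then have "integrable \<nu> (\<lambda>y. indicator (laguerre_cell g N x \<phi>h i) y * (norm (?T (x i) - y))\<^sup>2)"
      using integrable_mult_indicator[of "laguerre_cell g N x \<phi>h i" \<nu> "\<lambda>y. (norm (?T (x i) - y))\<^sup>2"] cell_properties(1)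
        P2_D(2)[OF setting_P2(2)] by (simp add: square_integrable_def)
    then show ?thesis
      by (subst nn_integral_eq_integral[symmetric])
         (auto intro!: nn_integral_cong split: split_indicator)
  qed
  have "ennreal ((L2_norm glued (\<lambda>q. ?T (Z q) - Y q))\<^sup>2)
      = (\<integral>\<^sup>+q. ennreal ((norm (?T (Z q) - Y q))\<^sup>2) \<partial>glued)"
    by (intro nn_integral_norm_power2[symmetric] square_integrable_diff sq_TZ sq_Y)
  also have "\<dots> = (\<Sum>i\<in>{1..N}. \<integral>\<^sup>+y. indicator (laguerre_cell g N x \<phi>h i) y * ennreal ((norm (?T (x i) - y))\<^sup>2) \<partial>\<nu>)"
    using nn_integral_glued_snd[of "\<lambda>q. ennreal ((norm (?T (fst q) - snd q))\<^sup>2)"]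
    by (simp add: Z_def Y_def)
  also have "\<dots> = ennreal (\<Sum>i=1..N. \<integral>y. indicator (laguerre_cell g N x \<phi>h i) y * (norm (?T (x i) - y))\<^sup>2 \<partial>\<nu>)"
    unfolding cell_int by (intro sum_ennreal integral_nonneg_AE) auto
  finally have "(\<Sum>i=1..N. \<integral>y. indicator (laguerre_cell g N x \<phi>h i) y * (norm (?T (x i) - y))\<^sup>2 \<partial>\<nu>)
      = (L2_norm glued (\<lambda>q. ?T (Z q) - Y q))\<^sup>2"
    by (subst (asm) ennreal_inj) (auto intro!: sum_nonneg integral_nonneg_AE)
  also have "\<dots> \<le> (2 * sqrt lam * sqrt a * sqrt (W2 \<mu> \<nu> + a) + lam * a)\<^sup>2"
    using TZY by (rule power_mono) simp
  finally show ?thesis .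
qed

text \<open>Each summand is bounded by the moment of its cell about
  \<open>gradient \<phi> (x i)\<close> through \<open>cell_moment_lower_bound\<close>, and the sum
  of these moments by \<open>error_sum_le\<close>.\<close>

lemma semidiscrete_error_estimate:
  assumes c1_pos: "0 < c1"
  shows "(\<Sum>i=1..N. w i * ((norm (gradient \<phi> (x i) - cell_barycenter g N x w \<phi>h i))\<^sup>2
      + cell_constant TYPE('a) c1 c2 * (diameter (laguerre_cell g N x \<phi>h i))\<^sup>2))
    \<le> (error_bound lam \<mu> \<nu> (discrete_measure N x w))\<^sup>2"
    (is "?S \<le> _")
proof -
  let ?a = "W2 \<mu> (discrete_measure N x w)"
  let ?B = "\<lambda>e. (2 * sqrt lam * sqrt (?a + e) * sqrt (W2 \<mu> \<nu> + (?a + e)) + lam * (?a + e))\<^sup>2"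
  have "?S \<le> (\<Sum>i=1..N. \<integral>y. indicator (laguerre_cell g N x \<phi>h i) y * (norm (gradient \<phi> (x i) - y))\<^sup>2 \<partial>\<nu>)"
  proof (rule sum_mono)
    fix i assume i: "i \<in> {1..N}"
    note wi = solution_D(3,4)[OF i]
    have bary: "cell_barycenter g N x w \<phi>h i = (1 / measure \<nu> (laguerre_cell g N x \<phi>h i)) *\<^sub>R
        (LINT y:laguerre_cell g N x \<phi>h i|lborel. g y *\<^sub>R y)"
      by (simp add: cell_barycenter_def wi)
    show "w i * ((norm (gradient \<phi> (x i) - cell_barycenter g N x w \<phi>h i))\<^sup>2
        + cell_constant TYPE('a) c1 c2 * (diameter (laguerre_cell g N x \<phi>h i))\<^sup>2)
        \<le> (\<integral>y. indicator (laguerre_cell g N x \<phi>h i) y * (norm (gradient \<phi> (x i) - y))\<^sup>2 \<partial>\<nu>)"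
      using cell_moment_lower_bound[OF setting_P2(2) setting_density cell_properties(1-3) _ c1_pos
          cell_properties(4) bary] wi by simp
  qed
  then have le: "?S \<le> ?B e" if "0 < e" for e
    using error_sum_le[OF that] by (rule order_trans)
  \<comment> \<open>The bound is continuous in the slack, so the slack can be sent to zero.\<close>
  have "(?B \<longlongrightarrow> ?B 0) (at_right 0)"
    by (intro tendsto_intros)
  moreover have "\<forall>\<^sub>F e in at_right 0. ?S \<le> ?B e"
    using eventually_at_right_less[of "0::real"] by eventually_elim (rule le)
  ultimately have "?S \<le> ?B 0"
    by (rule tendsto_lowerbound) simp
  then show ?thesis
    by (simp add: error_bound_def)
qed

end

end

text \<open>\<open>H\<close> must be chosen before \<open>lam\<close>, \<open>f\<close>,
  \<open>g\<close> and \<phi>. The variance bound \<open>k\<close> obtained from one admissible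
  choice speaks only of \<nu> and so serves all others; if there is no admissible choice, the claim
  is vacuous.\<close>

lemma regularity_lower_bound:
  fixes \<mu> \<nu> :: "'a::euclidean_space measure"
  assumes "0 < c1"
  obtains H where "\<And>lam f g \<phi>. transport_setting c1 c2 lam \<mu> \<nu> f g \<phi> \<Longrightarrow> inverse lam \<le> H"
proof (cases "\<exists>lam f g \<phi>. transport_setting c1 c2 lam \<mu> \<nu> f g \<phi>")
  case True
  then obtain k where k: "0 < k" "\<And>p. k \<le> (\<integral>y. (norm (p - y))\<^sup>2 \<partial>\<nu>)"
    using variance_lower_bound[OF _ assms] by metis
  have "inverse lam \<le> sqrt ((\<integral>x. (norm x)\<^sup>2 \<partial>\<mu>) / k)"
    if "transport_setting c1 c2 lam \<mu> \<nu> f g \<phi>" for lam f g \<phi>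
  proof (rule real_le_rsqrt)
    have lam: "0 < lam"
      using setting_lam_pos[OF that] .
    have "k \<le> lam\<^sup>2 * (\<integral>x. (norm x)\<^sup>2 \<partial>\<mu>)"
      using order_trans[OF k(2) variance_le[OF that]] .
    then show "(inverse lam)\<^sup>2 \<le> (\<integral>x. (norm x)\<^sup>2 \<partial>\<mu>) / k"
      using k(1) lam by (simp add: field_simps power_inverse)
  qed
  then show thesis
    by (rule that)
next
  case False
  then show thesis
    using that by blast
qed

text \<open>The square of the sum is at most twice the sum of the squares. The estimate
  \<open>lam * h \<le> 1\<close> makes the second square linear in \<open>lam * h\<close>, and
  \<open>a \<le> h \<le> H\<close> bounds the remaining factor of the first.\<close>

lemma error_bound_power2_le:
  assumes lam: "0 < lam" and a: "W2 \<mu> \<sigma> \<le> h" and h: "0 < h" "h \<le> inverse lam" "inverse lam \<le> H"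
  shows "(error_bound lam \<mu> \<nu> \<sigma>)\<^sup>2 \<le> (8 * (W2 \<mu> \<nu> + H) + 2) * lam * h"
proof -
  define a where "a = W2 \<mu> \<sigma>"
  define b where "b = W2 \<mu> \<nu>"
  have ab: "0 \<le> a" "0 \<le> b" "a \<le> h"
    using a by (auto simp: a_def b_def W2_nonneg)
  have lh: "lam * h \<le> 1"
    using mult_left_mono[OF h(2), of lam] lam by simp
  let ?u = "2 * sqrt lam * sqrt a * sqrt (b + a)"
  have "(error_bound lam \<mu> \<nu> \<sigma>)\<^sup>2 = (?u + lam * a)\<^sup>2"
    by (simp add: error_bound_def a_def b_def)
  also have "\<dots> \<le> 2 * ?u\<^sup>2 + 2 * (lam * a)\<^sup>2"
    using sum_squares_bound[of ?u "lam * a"] by (simp add: power2_sum)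
  also have "\<dots> = 8 * ((lam * a) * (b + a)) + 2 * ((lam * a) * (lam * a))"
  proof -
    have "?u\<^sup>2 = 4 * ((lam * a) * (b + a))"
      using ab lam by (simp add: power_mult_distrib)
    then show ?thesis
      by (simp only: power2_eq_square[of "lam * a"])
  qed
  also have "\<dots> \<le> 8 * ((lam * h) * (b + H)) + 2 * ((lam * h) * 1)"
  proof -
    have "a \<le> H"
      using ab h by simp
    moreover have "lam * a \<le> lam * h"
      using ab lam by simp
    moreover from this have "lam * a \<le> 1"
      using lh by (rule order_trans)
    ultimately show ?thesis
      using ab lam h lh by (intro add_mono mult_left_mono mult_mono) auto
  qed
  also have "\<dots> = (8 * (W2 \<mu> \<nu> + H) + 2) * lam * h"
    by (simp add: b_def algebra_simps)
  finally show ?thesis .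
qed

theorem corollary4p2:
  fixes c1 c2 :: real
  assumes "0 < c1" and "c1 \<le> c2"
  shows
    "(\<exists>C>0. \<forall>lam (\<mu> :: 'a::euclidean_space measure) \<nu> f g \<phi> N x w \<phi>h.
        transport_setting c1 c2 lam \<mu> \<nu> f g \<phi> \<and> semidiscrete_solution \<nu> g N x w \<phi>h \<longrightarrow>
        (\<Sum>i=1..N. w i * ((norm (gradient \<phi> (x i) - cell_barycenter g N x w \<phi>h i))\<^sup>2
                          + C * (diameter (laguerre_cell g N x \<phi>h i))\<^sup>2))
          \<le> (error_bound lam \<mu> \<nu> (discrete_measure N x w))\<^sup>2)
     \<and>
     (\<forall>(\<mu> :: 'a measure) \<nu>. \<exists>C. \<forall>lam f g \<phi> N x w \<phi>h h.
        transport_setting c1 c2 lam \<mu> \<nu> f g \<phi> \<and> semidiscrete_solution \<nu> g N x w \<phi>h \<and>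
        0 < h \<and> h \<le> inverse lam \<and> W2 \<mu> (discrete_measure N x w) \<le> h \<longrightarrow>
        (\<Sum>i=1..N. w i * (norm (gradient \<phi> (x i) - cell_barycenter g N x w \<phi>h i))\<^sup>2) \<le> C * lam * h \<and>
        (\<Sum>i=1..N. w i * (diameter (laguerre_cell g N x \<phi>h i))\<^sup>2) \<le> C * lam * h)"
proof (intro conjI)
  define K where "K = cell_constant TYPE('a) c1 c2"
  have K: "0 < K"
    using assms by (simp add: K_def cell_constant_def)
  show "\<exists>C>0. \<forall>lam (\<mu> :: 'a measure) \<nu> f g \<phi> N x w \<phi>h.
        transport_setting c1 c2 lam \<mu> \<nu> f g \<phi> \<and> semidiscrete_solution \<nu> g N x w \<phi>h \<longrightarrow>
        (\<Sum>i=1..N. w i * ((norm (gradient \<phi> (x i) - cell_barycenter g N x w \<phi>h i))\<^sup>2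
                          + C * (diameter (laguerre_cell g N x \<phi>h i))\<^sup>2))
          \<le> (error_bound lam \<mu> \<nu> (discrete_measure N x w))\<^sup>2"
    using K semidiscrete_error_estimate[OF _ _ assms(1)] unfolding K_def by blast
  show "\<forall>(\<mu> :: 'a measure) \<nu>. \<exists>C. \<forall>lam f g \<phi> N x w \<phi>h h.
        transport_setting c1 c2 lam \<mu> \<nu> f g \<phi> \<and> semidiscrete_solution \<nu> g N x w \<phi>h \<and>
        0 < h \<and> h \<le> inverse lam \<and> W2 \<mu> (discrete_measure N x w) \<le> h \<longrightarrow>
        (\<Sum>i=1..N. w i * (norm (gradient \<phi> (x i) - cell_barycenter g N x w \<phi>h i))\<^sup>2) \<le> C * lam * h \<and>
        (\<Sum>i=1..N. w i * (diameter (laguerre_cell g N x \<phi>h i))\<^sup>2) \<le> C * lam * h"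
  proof (intro allI)
    fix \<mu> \<nu> :: "'a measure"
    obtain H where H: "\<And>lam f g \<phi>. transport_setting c1 c2 lam \<mu> \<nu> f g \<phi> \<Longrightarrow> inverse lam \<le> H"
      using regularity_lower_bound[OF assms(1)] by metis
    define C0 where "C0 = 8 * (W2 \<mu> \<nu> + H) + 2"
    \<comment> \<open>The joint estimate bounds the first sum plus \<open>K\<close> times the second
      by \<open>C0 * lam * h\<close>. Dropping either nonnegative part gives the constants
      \<open>C0\<close> and \<open>C0 / K\<close>, and the maximum covers both.\<close>
    have "(\<Sum>i=1..N. w i * (norm (gradient \<phi> (x i) - cell_barycenter g N x w \<phi>h i))\<^sup>2) \<le> max C0 (C0 / K) * lam * h \<and>
        (\<Sum>i=1..N. w i * (diameter (laguerre_cell g N x \<phi>h i))\<^sup>2) \<le> max C0 (C0 / K) * lam * h"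
      if "transport_setting c1 c2 lam \<mu> \<nu> f g \<phi> \<and> semidiscrete_solution \<nu> g N x w \<phi>h \<and>
        0 < h \<and> h \<le> inverse lam \<and> W2 \<mu> (discrete_measure N x w) \<le> h"
      for lam f g \<phi> N x w \<phi>h h
    proof -
      from that have setting: "transport_setting c1 c2 lam \<mu> \<nu> f g \<phi>"
        and solution: "semidiscrete_solution \<nu> g N x w \<phi>h"
        and h: "0 < h" "h \<le> inverse lam" "W2 \<mu> (discrete_measure N x w) \<le> h"
        by auto
      note lam = setting_lam_pos[OF setting]
      let ?A = "\<Sum>i=1..N. w i * (norm (gradient \<phi> (x i) - cell_barycenter g N x w \<phi>h i))\<^sup>2"
      let ?D = "\<Sum>i=1..N. w i * (diameter (laguerre_cell g N x \<phi>h i))\<^sup>2"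
      have w: "0 \<le> w i" if "i \<in> {1..N}" for i
        using solution_D(3)[OF setting solution that] by simp
      have nonneg: "0 \<le> ?A" "0 \<le> ?D"
        using w by (auto intro!: sum_nonneg)
      have "?A + K * ?D = (\<Sum>i=1..N. w i * ((norm (gradient \<phi> (x i) - cell_barycenter g N x w \<phi>h i))\<^sup>2
          + K * (diameter (laguerre_cell g N x \<phi>h i))\<^sup>2))"
        by (simp add: distrib_left sum.distrib sum_distrib_left mult.left_commute)
      also have "\<dots> \<le> (error_bound lam \<mu> \<nu> (discrete_measure N x w))\<^sup>2"
        unfolding K_def by (rule semidiscrete_error_estimate[OF setting solution assms(1)])
      also have "\<dots> \<le> C0 * lam * h"
        unfolding C0_def by (rule error_bound_power2_le[OF lam h(3,1,2) H[OF setting]])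
      finally have sum: "?A + K * ?D \<le> C0 * (lam * h)"
        by (simp add: mult.assoc)
      have "?A \<le> C0 * (lam * h)"
        using sum nonneg K by (smt (verit) mult_nonneg_nonneg)
      also have "\<dots> \<le> max C0 (C0 / K) * (lam * h)"
        using lam h by (intro mult_right_mono) auto
      finally have A: "?A \<le> max C0 (C0 / K) * (lam * h)" .
      have "?D \<le> C0 / K * (lam * h)"
        using sum nonneg K by (simp add: field_simps)
      also have "\<dots> \<le> max C0 (C0 / K) * (lam * h)"
        using lam h by (intro mult_right_mono) auto
      finally show ?thesis
        using A by (simp add: mult.assoc)
    qed
    then show "\<exists>C. \<forall>lam f g \<phi> N x w \<phi>h h.
        transport_setting c1 c2 lam \<mu> \<nu> f g \<phi> \<and> semidiscrete_solution \<nu> g N x w \<phi>h \<and>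
        0 < h \<and> h \<le> inverse lam \<and> W2 \<mu> (discrete_measure N x w) \<le> h \<longrightarrow>
        (\<Sum>i=1..N. w i * (norm (gradient \<phi> (x i) - cell_barycenter g N x w \<phi>h i))\<^sup>2) \<le> C * lam * h \<and>
        (\<Sum>i=1..N. w i * (diameter (laguerre_cell g N x \<phi>h i))\<^sup>2) \<le> C * lam * h"
      by blast
  qed
qed

end
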